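(* Let $\Re(\gamma)>-1$, $\Re(\mu)>0$, $\Re(\beta)>0$, $w\in\mathbb{C}\setminus\{0\}$, $1\le m\le q$, $0\le n\le p$ and $\Re(\beta)+\min_{1\le j\le m}\Re\left(\frac{\alpha b_j}{\beta_j}\right)>0$. Let $x>a$, with $\left|\frac{x-u}{x-a}\right|<1$ for the integration variable $u$. Then $$\left(\mathcal{H}^{w;m,n;\alpha}_{a+;p,q;\beta}\,I^{\gamma,\mu}_{a+}\phi\right)(x)=\int_a^x u^{\gamma}(x-u)^{\mu+\beta-1}\,\frac{(x-a)^{-\mu-\gamma}}{\Gamma(\mu+\gamma)}\;H^{0,1:m,n;1,1}_{1,1:p,q;1,1}\left[\begin{array}{c} w(x-u)^{\alpha}\\ -\frac{x-u}{x-a}\end{array}\left|\begin{array}{l}(1-\beta;\alpha,1):(a_j,\alpha_j)_{1,p};(1-\mu-\gamma,1)\\ (1-\mu-\beta;\alpha,1):(b_j,\beta_j)_{1,q};(0,1)\end{array}\right.\right]\phi(u)\,du .$$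
   Context: Throughout, $a\in\mathbb{R}$, $x>a$, $\alpha>0$, $\mu,\gamma,\beta\in\mathbb{C}$; powers are principal values; $(a_j,\alpha_j)_{1,p}$ stands for the list $(a_1,\alpha_1),\dots,(a_p,\alpha_p)$, with $a_j,b_j\in\mathbb{C}$ and $\alpha_j,\beta_j>0$. Fox $H$-function: for $z\neq0$, $$H^{m,n}_{p,q}[z]=H^{m,n}_{p,q}\left[z\left|\begin{array}{c}(a_j,\alpha_j)_{1,p}\\(b_j,\beta_j)_{1,q}\end{array}\right.\right]=\frac1{2\pi i}\int_L\varphi(\xi)z^{\xi}\,d\xi,\qquad \varphi(\xi)=\frac{\prod_{j=1}^m\Gamma(b_j-\beta_j\xi)\prod_{j=1}^n\Gamma(1-a_j+\alpha_j\xi)}{\prod_{j=m+1}^q\Gamma(1-b_j+\beta_j\xi)\prod_{j=n+1}^p\Gamma(a_j-\alpha_j\xi)},$$ where $L$ is a suitable contour (running from $-i\infty$ to $+i\infty$, or a loop) separating the poles of $\Gamma(b_j-\beta_j\xi)$, $j\le m$ (to its right), from those of $\Gamma(1-a_j+\alpha_j\xi)$, $j\le n$ (to its left); as usual these two sets of poles are assumed disjoint and the integral is assumed to converge absolutely. $H$-function of two variables: $$H^{0,n_1:m_2,n_2;m_3,n_3}_{p_1,q_1:p_2,q_2;p_3,q_3}\left[\begin{array}{c}X\\ Y\end{array}\left|\begin{array}{l}(a'_j;\alpha'_j,A_j)_{1,p_1}:(c_j,\gamma_j)_{1,p_2};(e_j,E_j)_{1,p_3}\\(b'_j;\beta'_j,B_j)_{1,q_1}:(d_j,\delta_j)_{1,q_2};(f_j,F_j)_{1,q_3}\end{array}\right.\right]=\frac{1}{(2\pi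 i)^2}\int_{L_1}\int_{L_2}\Phi(\xi,\eta)\,\theta_1(\xi)\,\theta_2(\eta)\,X^{\xi}Y^{\eta}\,d\eta\,d\xi,$$ $$\Phi(\xi,\eta)=\frac{\prod_{j=1}^{n_1}\Gamma(1-a'_j+\alpha'_j\xi+A_j\eta)}{\prod_{j=n_1+1}^{p_1}\Gamma(a'_j-\alpha'_j\xi-A_j\eta)\prod_{j=1}^{q_1}\Gamma(1-b'_j+\beta'_j\xi+B_j\eta)},$$ where $\theta_1$ is the function $\varphi$ above formed with indices $m_2,n_2,p_2,q_2$ and parameters $(c_j,\gamma_j),(d_j,\delta_j)$, and $\theta_2$ is the one formed with $m_3,n_3,p_3,q_3$ and $(e_j,E_j),(f_j,F_j)$. The contours $L_1,L_2$ separate the poles of the Gamma functions whose arguments decrease in the variable from the poles of those whose arguments increase (these sets of poles being disjoint); when $|Y|<1$, $L_2$ may be taken as a loop starting and ending at $+\infty$ (from below to above the real axis) and enclosing exactly the poles of the factors $\Gamma(f_j-F_j\eta)$, $j\le m_3$. Operators: $$(I^{\gamma,\mu}_{a+}f)(x)=\frac{(x-a)^{-\mu-\gamma}}{\Gamma(\mu)}\int_a^x\frac{t^{\gamma}f(t)}{(x-t)^{1-\mu}}\,dt\qquad(\Re(\gamma)>-1,\ \Re(\mu)>0),$$ $$\left(\mathcal{H}^{w;m,n;\alpha}_{a+;p,q;\beta}\varphi\right)(x)=\int_a^x(x-t)^{\beta-1}H^{m,n}_{p,q}[w(x-t)^{\alpha}]\varphi(t)\,dt,$$ where the $H$-function has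 parameters $(a_j,\alpha_j)_{1,p}$, $(b_j,\beta_j)_{1,q}$. The function $\phi$ is any complex-valued integrable function for which the integrals occurring on both sides, including the iterated ones, exist and converge absolutely. *)

theory Defs
  imports "HOL-Analysis.Analysis"
begin

text \<open>
  A parameter list \<open>[(a\<^sub>1, \<alpha>\<^sub>1), \<dots>, (a\<^sub>p, \<alpha>\<^sub>p)]\<close> carries its own length, so \<open>p\<close> and \<open>q\<close> are the lengths
  of the upper and lower list. \<open>Gamma\<close> is \<open>0\<close> at its poles, hence a Gamma factor in a
  denominator gives \<open>1 / Gamma = 0\<close> there, as it should; the poles of the numerator factors never
  lie on an admissible contour.
\<close>

definition fox_kernel ::
  "nat \<Rightarrow> nat \<Rightarrow> (complex \<times> real) list \<Rightarrow> (complex \<times> real) list \<Rightarrow> complex \<Rightarrow> complex" where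
  "fox_kernel m n ups lows \<xi> =
     (\<Prod>(b, v)\<leftarrow>take m lows. Gamma (b - of_real v * \<xi>)) *
     (\<Prod>(a, v)\<leftarrow>take n ups. Gamma (1 - a + of_real v * \<xi>)) /
     ((\<Prod>(b, v)\<leftarrow>drop m lows. Gamma (1 - b + of_real v * \<xi>)) *
      (\<Prod>(a, v)\<leftarrow>drop n ups. Gamma (a - of_real v * \<xi>)))"

definition decreasing_poles :: "nat \<Rightarrow> (complex \<times> real) list \<Rightarrow> complex set" where
  "decreasing_poles m lows = {\<xi>. \<exists>(b, v)\<in>set (take m lows). b - of_real v * \<xi> \<in> \<int>\<^sub>\<le>\<^sub>0}"

definition increasing_poles :: "nat \<Rightarrow> (complex \<times> real) list \<Rightarrow> complex set" where
  "increasing_poles n ups = {\<xi>. \<exists>(a, v)\<in>set (take n ups). 1 - a + of_real v * \<xi> \<in> \<int>\<^sub>\<le>\<^sub>0}"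

text \<open>Infinite contours are parametrised by the whole real line.\<close>

definition contour_curve :: "(real \<Rightarrow> complex) \<Rightarrow> bool" where
  "contour_curve g \<longleftrightarrow> (\<forall>s t. g piecewise_C1_differentiable_on {s..t})"

definition line_integrand :: "(real \<Rightarrow> complex) \<Rightarrow> (complex \<Rightarrow> complex) \<Rightarrow> real \<Rightarrow> complex" where
  "line_integrand g f s = f (g s) * vector_derivative g (at s)"

definition line_integral :: "(real \<Rightarrow> complex) \<Rightarrow> (complex \<Rightarrow> complex) \<Rightarrow> complex" where
  "line_integral g f = (LINT s|lborel. line_integrand g f s)"

text \<open>
  The three kinds of contour: from \<open>-\<i>\<infinity>\<close> to \<open>+\<i>\<infinity>\<close> inside a vertical strip, a loop from
  \<open>+\<infinity> + \<i>c\<close> to \<open>+\<infinity> + \<i>d\<close>, and a loop from \<open>-\<infinity> + \<i>c\<close> to \<open>-\<infinity> + \<i>d\<close>, where \<open>c < d\<close>.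
\<close>

definition vertical_contour :: "(real \<Rightarrow> complex) \<Rightarrow> bool" where
  "vertical_contour g \<longleftrightarrow> contour_curve g \<and> bounded (range (\<lambda>s. Re (g s))) \<and>
     filterlim (\<lambda>s. Im (g s)) at_bot at_bot \<and> filterlim (\<lambda>s. Im (g s)) at_top at_top"

definition right_loop :: "real \<Rightarrow> real \<Rightarrow> (real \<Rightarrow> complex) \<Rightarrow> bool" where
  "right_loop c d g \<longleftrightarrow> contour_curve g \<and> c < d \<and>
     filterlim (\<lambda>s. Re (g s)) at_top at_bot \<and> filterlim (\<lambda>s. Re (g s)) at_top at_top \<and>
     ((\<lambda>s. Im (g s)) \<longlongrightarrow> c) at_bot \<and> ((\<lambda>s. Im (g s)) \<longlongrightarrow> d) at_top"

definition left_loop :: "real \<Rightarrow> real \<Rightarrow> (real \<Rightarrow> complex) \<Rightarrow> bool" where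
  "left_loop c d g \<longleftrightarrow> contour_curve g \<and> c < d \<and>
     filterlim (\<lambda>s. Re (g s)) at_bot at_bot \<and> filterlim (\<lambda>s. Re (g s)) at_bot at_top \<and>
     ((\<lambda>s. Im (g s)) \<longlongrightarrow> c) at_bot \<and> ((\<lambda>s. Im (g s)) \<longlongrightarrow> d) at_top"

text \<open>
  The side of \<open>g\<close> containing the far end of the ray \<open>\<rho>\<close>. For a loop the enclosed side is
  reached along the ray halfway between its two ends.
\<close>

definition side_of :: "(real \<Rightarrow> complex) \<Rightarrow> (real \<Rightarrow> complex) \<Rightarrow> complex set" where
  "side_of g \<rho> = {z. \<forall>\<^sub>F r in at_top. connected_component (- range g) z (\<rho> r)}"

text \<open>\<open>g\<close> has the points of \<open>P\<close> on its right and those of \<open>Q\<close> on its left.\<close>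

definition separates :: "(real \<Rightarrow> complex) \<Rightarrow> complex set \<Rightarrow> complex set \<Rightarrow> bool" where
  "separates g P Q \<longleftrightarrow>
     vertical_contour g \<and>
       P \<subseteq> side_of g (\<lambda>r. Complex r 0) \<and> Q \<subseteq> side_of g (\<lambda>r. Complex (- r) 0) \<or>
     (\<exists>c d. right_loop c d g \<and>
       P \<subseteq> side_of g (\<lambda>r. Complex r ((c + d) / 2)) \<and> Q \<subseteq> side_of g (\<lambda>r. Complex (- r) 0)) \<or>
     (\<exists>c d. left_loop c d g \<and>
       P \<subseteq> side_of g (\<lambda>r. Complex r 0) \<and> Q \<subseteq> side_of g (\<lambda>r. Complex (- r) ((c + d) / 2)))"

text \<open>The Fox H-function at \<open>z\<close>, computed along the contour \<open>L\<close>.\<close>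

definition fox_H ::
  "(real \<Rightarrow> complex) \<Rightarrow> nat \<Rightarrow> nat \<Rightarrow> (complex \<times> real) list \<Rightarrow> (complex \<times> real) list \<Rightarrow>
   complex \<Rightarrow> complex" where
  "fox_H L m n ups lows z =
     1 / (2 * of_real pi * \<i>) * line_integral L (\<lambda>\<xi>. fox_kernel m n ups lows \<xi> * z powr \<xi>)"

definition fox_H_contour ::
  "(real \<Rightarrow> complex) \<Rightarrow> nat \<Rightarrow> nat \<Rightarrow> (complex \<times> real) list \<Rightarrow> (complex \<times> real) list \<Rightarrow>
   complex \<Rightarrow> bool" where
  "fox_H_contour L m n ups lows z \<longleftrightarrow>
     decreasing_poles m lows \<inter> increasing_poles n ups = {} \<and>
     separates L (decreasing_poles m lows) (increasing_poles n ups) \<and>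
     integrable lborel (line_integrand L (\<lambda>\<xi>. fox_kernel m n ups lows \<xi> * z powr \<xi>))"

text \<open>
  The H-function of two variables. Entries of \<open>ups\<^sub>1\<close> are triples \<open>(a'; \<alpha>', A)\<close>, those of \<open>lows\<^sub>1\<close> are
  triples \<open>(b'; \<beta>', B)\<close>.
\<close>

definition fox2_Phi ::
  "nat \<Rightarrow> (complex \<times> real \<times> real) list \<Rightarrow> (complex \<times> real \<times> real) list \<Rightarrow>
   complex \<Rightarrow> complex \<Rightarrow> complex" where
  "fox2_Phi n\<^sub>1 ups\<^sub>1 lows\<^sub>1 \<xi> \<eta> =
     (\<Prod>(a, v, u)\<leftarrow>take n\<^sub>1 ups\<^sub>1. Gamma (1 - a + of_real v * \<xi> + of_real u * \<eta>)) /
     ((\<Prod>(a, v, u)\<leftarrow>drop n\<^sub>1 ups\<^sub>1. Gamma (a - of_real v * \<xi> - of_real u * \<eta>)) *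
      (\<Prod>(b, v, u)\<leftarrow>lows\<^sub>1. Gamma (1 - b + of_real v * \<xi> + of_real u * \<eta>)))"

definition fox2_integrand ::
  "nat \<Rightarrow> (complex \<times> real \<times> real) list \<Rightarrow> (complex \<times> real \<times> real) list \<Rightarrow>
   nat \<Rightarrow> nat \<Rightarrow> (complex \<times> real) list \<Rightarrow> (complex \<times> real) list \<Rightarrow>
   nat \<Rightarrow> nat \<Rightarrow> (complex \<times> real) list \<Rightarrow> (complex \<times> real) list \<Rightarrow>
   complex \<Rightarrow> complex \<Rightarrow> complex \<Rightarrow> complex \<Rightarrow> complex" where
  "fox2_integrand n\<^sub>1 ups\<^sub>1 lows\<^sub>1 m\<^sub>2 n\<^sub>2 ups\<^sub>2 lows\<^sub>2 m\<^sub>3 n\<^sub>3 ups\<^sub>3 lows\<^sub>3 X Y \<xi> \<eta> =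
     fox2_Phi n\<^sub>1 ups\<^sub>1 lows\<^sub>1 \<xi> \<eta> * fox_kernel m\<^sub>2 n\<^sub>2 ups\<^sub>2 lows\<^sub>2 \<xi> *
     fox_kernel m\<^sub>3 n\<^sub>3 ups\<^sub>3 lows\<^sub>3 \<eta> * X powr \<xi> * Y powr \<eta>"

definition fox_H2 ::
  "(real \<Rightarrow> complex) \<Rightarrow> (real \<Rightarrow> complex) \<Rightarrow>
   nat \<Rightarrow> (complex \<times> real \<times> real) list \<Rightarrow> (complex \<times> real \<times> real) list \<Rightarrow>
   nat \<Rightarrow> nat \<Rightarrow> (complex \<times> real) list \<Rightarrow> (complex \<times> real) list \<Rightarrow>
   nat \<Rightarrow> nat \<Rightarrow> (complex \<times> real) list \<Rightarrow> (complex \<times> real) list \<Rightarrow>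
   complex \<Rightarrow> complex \<Rightarrow> complex" where
  "fox_H2 L\<^sub>1 L\<^sub>2 n\<^sub>1 ups\<^sub>1 lows\<^sub>1 m\<^sub>2 n\<^sub>2 ups\<^sub>2 lows\<^sub>2 m\<^sub>3 n\<^sub>3 ups\<^sub>3 lows\<^sub>3 X Y =
     1 / (2 * of_real pi * \<i>)\<^sup>2 * line_integral L\<^sub>1 (\<lambda>\<xi>. line_integral L\<^sub>2
       (fox2_integrand n\<^sub>1 ups\<^sub>1 lows\<^sub>1 m\<^sub>2 n\<^sub>2 ups\<^sub>2 lows\<^sub>2 m\<^sub>3 n\<^sub>3 ups\<^sub>3 lows\<^sub>3 X Y \<xi>))"

definition mixed_poles ::
  "nat \<Rightarrow> (complex \<times> real \<times> real) list \<Rightarrow> (complex \<times> complex) set" where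
  "mixed_poles n\<^sub>1 ups\<^sub>1 =
     {(\<xi>, \<eta>). \<exists>(a, v, u)\<in>set (take n\<^sub>1 ups\<^sub>1). 1 - a + of_real v * \<xi> + of_real u * \<eta> \<in> \<int>\<^sub>\<le>\<^sub>0}"

text \<open>
  The Gamma factors in the numerator of \<open>\<Phi>\<close> increase in both variables, so for \<open>\<eta>\<close> on \<open>L\<^sub>2\<close> their
  poles in \<open>\<xi>\<close> lie to the left of \<open>L\<^sub>1\<close>, and for \<open>\<xi>\<close> on \<open>L\<^sub>1\<close> their poles in \<open>\<eta>\<close> lie to the left of
  \<open>L\<^sub>2\<close>.
\<close>

definition fox_H2_contours ::
  "(real \<Rightarrow> complex) \<Rightarrow> (real \<Rightarrow> complex) \<Rightarrow>
   nat \<Rightarrow> (complex \<times> real \<times> real) list \<Rightarrow> (complex \<times> real \<times> real) list \<Rightarrow>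
   nat \<Rightarrow> nat \<Rightarrow> (complex \<times> real) list \<Rightarrow> (complex \<times> real) list \<Rightarrow>
   nat \<Rightarrow> nat \<Rightarrow> (complex \<times> real) list \<Rightarrow> (complex \<times> real) list \<Rightarrow>
   complex \<Rightarrow> complex \<Rightarrow> bool" where
  "fox_H2_contours L\<^sub>1 L\<^sub>2 n\<^sub>1 ups\<^sub>1 lows\<^sub>1 m\<^sub>2 n\<^sub>2 ups\<^sub>2 lows\<^sub>2 m\<^sub>3 n\<^sub>3 ups\<^sub>3 lows\<^sub>3 X Y \<longleftrightarrow>
     (let P\<^sub>1 = decreasing_poles m\<^sub>2 lows\<^sub>2;
          Q\<^sub>1 = increasing_poles n\<^sub>2 ups\<^sub>2 \<union> {\<xi>. \<exists>\<eta>\<in>range L\<^sub>2. (\<xi>, \<eta>) \<in> mixed_poles n\<^sub>1 ups\<^sub>1};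
          P\<^sub>2 = decreasing_poles m\<^sub>3 lows\<^sub>3;
          Q\<^sub>2 = increasing_poles n\<^sub>3 ups\<^sub>3 \<union> {\<eta>. \<exists>\<xi>\<in>range L\<^sub>1. (\<xi>, \<eta>) \<in> mixed_poles n\<^sub>1 ups\<^sub>1}
      in P\<^sub>1 \<inter> Q\<^sub>1 = {} \<and> separates L\<^sub>1 P\<^sub>1 Q\<^sub>1 \<and> P\<^sub>2 \<inter> Q\<^sub>2 = {} \<and> separates L\<^sub>2 P\<^sub>2 Q\<^sub>2) \<and>
     integrable lborel (\<lambda>(s, r). line_integrand L\<^sub>1 (\<lambda>\<xi>. line_integrand L\<^sub>2
       (fox2_integrand n\<^sub>1 ups\<^sub>1 lows\<^sub>1 m\<^sub>2 n\<^sub>2 ups\<^sub>2 lows\<^sub>2 m\<^sub>3 n\<^sub>3 ups\<^sub>3 lows\<^sub>3 X Y \<xi>) r) s)"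

definition I_op :: "real \<Rightarrow> complex \<Rightarrow> complex \<Rightarrow> (real \<Rightarrow> complex) \<Rightarrow> real \<Rightarrow> complex" where
  "I_op a \<gamma> \<mu> f x =
     of_real (x - a) powr (- \<mu> - \<gamma>) / Gamma \<mu> *
     (LINT t:{a<..<x}|lborel. of_real t powr \<gamma> * f t / of_real (x - t) powr (1 - \<mu>))"

definition H_op ::
  "(real \<Rightarrow> complex) \<Rightarrow> real \<Rightarrow> complex \<Rightarrow> nat \<Rightarrow> nat \<Rightarrow> real \<Rightarrow>
   (complex \<times> real) list \<Rightarrow> (complex \<times> real) list \<Rightarrow> complex \<Rightarrow>
   (real \<Rightarrow> complex) \<Rightarrow> real \<Rightarrow> complex" where
  "H_op L a w m n \<alpha> ups lows \<beta> f x =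
     (LINT t:{a<..<x}|lborel. of_real (x - t) powr (\<beta> - 1) *
        fox_H L m n ups lows (w * of_real ((x - t) powr \<alpha>)) * f t)"

end

theory Submission
  imports Defs "HOL-Complex_Analysis.Complex_Analysis"
begin

text \<open>
  By Fubini, both sides are integrals over \<open>u\<close> and over the contour of \<open>\<xi>\<close>, and it suffices to
  compare the inner integrals at fixed \<open>u\<close> and \<open>\<xi>\<close>. With \<open>b = \<beta> + \<alpha> \<xi>\<close> and
  \<open>z = (x - u) / (x - a)\<close>, the substitution \<open>t = x - (x - u) \<tau>\<close> turns the inner integral on the left
  into Euler's integral of \<open>\<tau>\<^sup>b\<^sup>-\<^sup>1 (1 - \<tau>)\<^sup>\<mu>\<^sup>-\<^sup>1 (1 - z \<tau>)\<^sup>-\<^sup>\<mu>\<^sup>-\<^sup>\<gamma>\<close>, while the one on the right is the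
  Mellin-Barnes integral of \<open>\<Gamma>(\<mu> + \<gamma> + \<eta>) \<Gamma>(b + \<eta>) \<Gamma>(- \<eta>) (- z)\<^sup>\<eta> / \<Gamma>(b + \<mu> + \<eta>)\<close> along the
  loop. Both have the same expansion, a hypergeometric series in \<open>z\<close>: the first by the binomial
  series and the Beta integral, the second by summing residues at the natural numbers. The loop is
  an arbitrary, possibly self-intersecting curve, so the residue theorem is applied to its
  truncations at \<open>Re z = N + 1/2\<close>, closed by a vertical segment, after computing their winding numbers.
\<close>

section \<open>The Beta integral and Euler's integral\<close>

text \<open>No hypothesis directly bounds the real part of \<beta> + \<alpha> \<xi> from below along
  \<open>L\<close>, although Euler's integral requires it to be positive. Absolute convergence of
  the triple integral supplies this: almost every slice in t is integrable, while a power of \<tau>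
  whose exponent has real part at most -1 is not integrable at 0. The inner comparison is therefore
  an almost-everywhere statement, made where the remaining factors do not vanish.

  The closing segments drop out in the limit because shifting \<eta> by 1 multiplies the
  Mellin-Barnes integrand by a factor tending to z < 1. Geometric decay along the abscissae N + 1/2,
  which stay clear of the poles, then follows from the functional equation of Gamma, without
  asymptotics.

  The loop arrives below the real axis and leaves above it, so it winds -1 times around the
  naturals. This sign cancels the one in the residue -(-1)^k / k! of \<Gamma>(-\<eta>), and (-1)^k
  cancels against (-z)^k.\<close>

lemma set_integrable_Beta_complex:
  fixes a b :: complex
  assumes "Re a > 0" "Re b > 0"
  shows "set_integrable lborel {0<..<1}
    (\<lambda>t. of_real t powr (a - 1) * of_real (1 - t) powr (b - 1))"
proof -
  have "set_integrable lborel {0<..<1} (\<lambda>t. t powr (Re a - 1) * (1 - t) powr (Re b - 1))"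
    by (rule set_integrable_subset[OF integrable_Beta[OF assms]]) auto
  then show ?thesis
    unfolding set_integrable_def
    by (rule Bochner_Integration.integrable_bound)
      (auto simp: indicator_def norm_mult norm_powr_real_powr intro!: AE_I2)
qed

text \<open>Extended by zero, Euler's integrand is a density on the whole line, so that a product of
  Gamma values becomes the integral of a convolution.\<close>

definition Gamma_density :: "complex \<Rightarrow> real \<Rightarrow> complex" where
  "Gamma_density a t = indicator {0<..} t *\<^sub>R (of_real t powr (a - 1) / of_real (exp t))"

lemma measurable_Gamma_density [measurable]: "Gamma_density a \<in> borel_measurable borel"
  unfolding Gamma_density_def by measurable

lemma has_bochner_integral_Gamma_density:
  assumes "Re a > 0"
  shows "has_bochner_integral lborel (Gamma_density a) (Gamma a)"
proof -
  have "integrable lebesgue (Gamma_density a)"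
    using absolutely_integrable_Gamma_integral'[OF assms]
    unfolding set_integrable_def Gamma_density_def .
  then have *: "integrable lborel (Gamma_density a)"
    by (subst (asm) integrable_completion) auto
  have "set_integrable lborel {0<..} (\<lambda>t. of_real t powr (a - 1) / of_real (exp t))"
    using * unfolding set_integrable_def Gamma_density_def .
  from set_borel_integral_eq_integral(2)[OF this]
  have "integral\<^sup>L lborel (Gamma_density a) = Gamma a"
    unfolding set_lebesgue_integral_def Gamma_density_def
    using Gamma_integral_complex'[OF assms] by (simp add: integral_unique)
  with * show ?thesis by (simp add: has_bochner_integral_iff)
qed

text \<open>Substituting x = s t separates the variables: the powers of s and the Jacobian combine
  to s^(a+b-1), the exponentials to e^(-s), and what remains depends on t alone.\<close>

lemma Gamma_density_convolution:
  fixes a b :: complex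
  assumes "s > 0"
  shows "(LINT x|lborel. Gamma_density a x * Gamma_density b (s - x)) =
    Gamma_density (a + b) s *
    (LINT t:{0<..<1}|lborel. of_real t powr (a - 1) * of_real (1 - t) powr (b - 1))"
proof -
  have "(LINT x|lborel. Gamma_density a x * Gamma_density b (s - x)) =
      s *\<^sub>R (LINT t|lborel. Gamma_density a (0 + s * t) * Gamma_density b (s - (0 + s * t)))"
    using assms by (subst lborel_integral_real_affine[of s _ 0]) auto
  also have "\<dots> = (LINT t|lborel. Gamma_density (a + b) s * (indicator {0<..<1} t *\<^sub>R
      (of_real t powr (a - 1) * of_real (1 - t) powr (b - 1))))"
  proof (subst integral_scaleR_right[symmetric], rule Bochner_Integration.integral_cong[OF refl])
    fix t :: real
    show "s *\<^sub>R (Gamma_density a (0 + s * t) * Gamma_density b (s - (0 + s * t))) =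
      Gamma_density (a + b) s * (indicator {0<..<1} t *\<^sub>R
      (of_real t powr (a - 1) * of_real (1 - t) powr (b - 1)))"
    proof (cases "0 < t \<and> t < 1")
      case True
      have e: "s - s * t = s * (1 - t)" by (simp add: algebra_simps)
      have "complex_of_real (s * t) powr (a - 1) = of_real s powr (a - 1) * of_real t powr (a - 1)"
        using True assms by (simp add: powr_times_real)
      moreover have "complex_of_real (s * (1 - t)) powr (b - 1) =
          of_real s powr (b - 1) * of_real (1 - t) powr (b - 1)"
        using True assms unfolding of_real_mult by (intro powr_times_real) auto
      moreover have "complex_of_real s * (of_real s powr (a - 1) * of_real s powr (b - 1)) =
          of_real s powr (a + b - 1)"
        using assms by (simp add: powr_diff powr_add field_simps)
      moreover have "exp (s * t) * exp (s * (1 - t)) = exp s"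
        by (simp add: exp_add[symmetric] algebra_simps)
      moreover have "Gamma_density a (0 + s * t) * Gamma_density b (s - (0 + s * t)) =
          of_real (s * t) powr (a - 1) * of_real (s * (1 - t)) powr (b - 1) /
          of_real (exp (s * t) * exp (s * (1 - t)))"
        using True assms by (simp add: Gamma_density_def e)
      ultimately show ?thesis
        using True assms by (simp add: Gamma_density_def scaleR_conv_of_real mult_ac)
    next
      case False
      then have "t \<le> 0 \<or> t \<ge> 1" by auto
      then have "s * t \<le> 0 \<or> s * t \<ge> s"
        using assms by (auto simp: mult_le_0_iff)
      then show ?thesis using False by (auto simp: Gamma_density_def)
    qed
  qed
  finally show ?thesis by (simp only: set_lebesgue_integral_def integral_mult_right_zero)
qed

text \<open>Integrating the convolution of two Gamma densities in both orders gives
  \<open>Gamma a * Gamma b\<close> one way and \<open>Gamma (a + b)\<close> times the integral the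
  other way.\<close>

theorem Beta_integral_complex:
  fixes a b :: complex
  assumes "Re a > 0" "Re b > 0"
  shows "(LINT t:{0<..<1}|lborel. of_real t powr (a - 1) * of_real (1 - t) powr (b - 1)) = Beta a b"
proof -
  let ?B = "LINT t:{0<..<1}|lborel. of_real t powr (a - 1) * of_real (1 - t) powr (b - 1)"
  have I: "integrable lborel (Gamma_density a)" "integrable lborel (Gamma_density b)"
    and E: "integral\<^sup>L lborel (Gamma_density a) = Gamma a"
      "integral\<^sup>L lborel (Gamma_density b) = Gamma b"
      "integral\<^sup>L lborel (Gamma_density (a + b)) = Gamma (a + b)"
    using has_bochner_integral_Gamma_density[of a] has_bochner_integral_Gamma_density[of b]
      has_bochner_integral_Gamma_density[of "a + b"] assms by (auto simp: has_bochner_integral_iff)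
  have shift: "(LINT s|lborel. f (s - x)) = integral\<^sup>L lborel f"
    for f :: "real \<Rightarrow> 'z :: {banach, second_countable_topology}" and x
    using lborel_integral_real_affine[of 1 f "- x"] by simp
  have int: "integrable (lborel \<Otimes>\<^sub>M lborel)
      (\<lambda>(x, s). Gamma_density a x * Gamma_density b (s - x))"
  proof (rule lborel_pair.Fubini_integrable)
    have "(LINT s|lborel. norm (Gamma_density a x * Gamma_density b (s - x))) =
        norm (Gamma_density a x) * (LINT s|lborel. norm (Gamma_density b s))" for x
      using shift[of "\<lambda>s. norm (Gamma_density b s)" x] by (simp add: norm_mult)
    then show "integrable lborel
        (\<lambda>x. LINT s|lborel. norm (case (x, s) of (x, s) \<Rightarrow> Gamma_density a x * Gamma_density b (s - x)))"
      using I by simp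
    have "integrable lborel (\<lambda>s. Gamma_density b (s - x))" for x
      using lborel_integrable_real_affine[OF I(2), of 1 "- x"] by simp
    then show "AE x in lborel. integrable lborel
        (\<lambda>s. case (x, s) of (x, s) \<Rightarrow> Gamma_density a x * Gamma_density b (s - x))"
      by simp
  qed measurable
  have "Gamma a * Gamma b = (LINT x|lborel. LINT s|lborel. Gamma_density a x * Gamma_density b (s - x))"
    by (simp add: shift[of "Gamma_density b"] E)
  also have "\<dots> = (LINT s|lborel. LINT x|lborel. Gamma_density a x * Gamma_density b (s - x))"
    using lborel_pair.Fubini_integral[OF int] by simp
  also have "\<dots> = (LINT s|lborel. Gamma_density (a + b) s * ?B)"
  proof (rule Bochner_Integration.integral_cong[OF refl])
    fix s :: real
    show "(LINT x|lborel. Gamma_density a x * Gamma_density b (s - x)) = Gamma_density (a + b) s * ?B"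
    proof (cases "s > 0")
      case True then show ?thesis by (rule Gamma_density_convolution)
    next
      case False
      then have "(\<lambda>x. Gamma_density a x * Gamma_density b (s - x)) = (\<lambda>x. 0)"
        by (auto simp: Gamma_density_def indicator_def)
      then have "(LINT x|lborel. Gamma_density a x * Gamma_density b (s - x)) = 0" by (simp only:) simp
      then show ?thesis using False by (simp add: Gamma_density_def)
    qed
  qed
  also have "\<dots> = Gamma (a + b) * ?B" by (simp add: E)
  finally have "Gamma a * Gamma b = Gamma (a + b) * ?B" .
  moreover have "a + b \<notin> \<int>\<^sub>\<le>\<^sub>0"
    using assms by (auto elim!: nonpos_Ints_cases dest!: arg_cong[where f = Re])
  ultimately show ?thesis by (simp add: Beta_def Gamma_eq_zero_iff field_simps)
qed

text \<open>Expand (1 - z t)^(-a) by the binomial series and integrate term by term; the factor t^k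
  shifts the first Beta argument. Since z t is at most z, the k-th term is bounded by |c k| z^k
  times a fixed integrable weight, and these bounds are summable because z < 1.\<close>

theorem Euler_integral_sums:
  fixes a b \<mu> :: complex and z :: real
  assumes "Re b > 0" "Re \<mu> > 0" "0 \<le> z" "z < 1"
  shows "(\<lambda>k. pochhammer a k / fact k * of_real z ^ k * Beta (b + of_nat k) \<mu>) sums
    (LINT t:{0<..<1}|lborel. of_real t powr (b - 1) * of_real (1 - t) powr (\<mu> - 1) *
       of_real (1 - z * t) powr (- a))"
proof -
  define c where "c k = pochhammer a k / fact k" for k
  define w :: "real \<Rightarrow> complex" where
    "w t = indicator {0<..<1} t *\<^sub>R (of_real t powr (b - 1) * of_real (1 - t) powr (\<mu> - 1))" for t
  define f where "f k t = w t * (c k * of_real (z * t) ^ k)" for k t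
  have w: "integrable lborel w"
    using set_integrable_Beta_complex[OF assms(1,2)] unfolding set_integrable_def w_def .
  have binomial: "(\<lambda>k. c k * of_real x ^ k) sums of_real (1 - x) powr (- a)" if "\<bar>x\<bar> < 1" for x :: real
  proof -
    have "(- a gchoose k) * (- of_real x) ^ k = c k * of_real x ^ k" for k
      by (simp add: c_def gbinomial_pochhammer power_minus[of "of_real x"])
    with gen_binomial_complex[of "- of_real x" "- a"] that show ?thesis by simp
  qed
  have abs: "summable (\<lambda>k. norm (c k * of_real x ^ k))" if "\<bar>x\<bar> < 1" for x :: real
  proof -
    \<comment> \<open>Convergence at the larger radius \<open>y\<close> gives absolute convergence
      at \<open>x\<close>.\<close>
    obtain y where "\<bar>x\<bar> < y" "y < 1" using \<open>\<bar>x\<bar> < 1\<close> dense by blast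
    then have "summable (\<lambda>k. c k * of_real y ^ k)"
      using binomial[of y] by (auto dest: sums_summable)
    then show ?thesis
      by (rule powser_insidea) (use \<open>\<bar>x\<bar> < y\<close> in auto)
  qed
  have zt: "\<bar>z * t\<bar> < 1" "0 \<le> z * t" "z * t \<le> z" if "0 < t" "t < 1" for t
  proof -
    show "0 \<le> z * t" using assms that by simp
    show "z * t \<le> z" using mult_left_mono[of t 1 z] assms that by simp
    then show "\<bar>z * t\<bar> < 1" using assms \<open>0 \<le> z * t\<close> by simp
  qed
  have bound: "norm (f k t) \<le> norm (norm (c k * of_real z ^ k) * norm (w t))" for k t
  proof (cases "0 < t \<and> t < 1")
    case True
    then have "norm (c k) * (z * t) ^ k \<le> norm (c k) * z ^ k"
      using zt[of t] by (intro mult_left_mono power_mono) auto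
    then have "norm (w t) * (norm (c k) * (z * t) ^ k) \<le> norm (w t) * (norm (c k) * z ^ k)"
      by (rule mult_left_mono[OF _ norm_ge_zero])
    moreover have "norm (f k t) = norm (w t) * (norm (c k) * (z * t) ^ k)"
      using zt(2)[of t] True unfolding f_def norm_mult norm_power norm_of_real by simp
    ultimately show ?thesis
      using assms by (simp only: norm_mult norm_power norm_of_real) (simp add: mult_ac)
  qed (simp add: f_def w_def)
  have [measurable]: "(\<lambda>t. f k t) \<in> borel_measurable borel" for k
    unfolding f_def w_def by measurable
  have f: "integrable lborel (f k)" for k
    by (rule Bochner_Integration.integrable_bound
        [OF integrable_mult_right[OF integrable_norm[OF w], of "norm (c k * of_real z ^ k)"]])
      (simp, intro AE_I2 bound)
  have f_sums: "(\<lambda>k. f k t) sums (w t * of_real (1 - z * t) powr (- a))" for t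
  proof (cases "0 < t \<and> t < 1")
    case True
    then show ?thesis
      unfolding f_def using zt[of t] by (intro sums_mult binomial) auto
  qed (simp add: f_def w_def)
  have "(\<lambda>k. integral\<^sup>L lborel (f k)) sums (LINT t|lborel. (\<Sum>k. f k t))"
  proof (rule sums_integral[OF f])
    show "AE t in lborel. summable (\<lambda>k. norm (f k t))"
    proof (rule AE_I2)
      fix t :: real
      show "summable (\<lambda>k. norm (f k t))"
      proof (cases "0 < t \<and> t < 1")
        case True
        then show ?thesis
          unfolding f_def norm_mult[of "w t"] using zt[of t] by (intro summable_mult abs) auto
      qed (simp add: f_def w_def)
    qed
    show "summable (\<lambda>k. LINT t|lborel. norm (f k t))"
    proof (rule summable_comparison_test)
      have "(LINT t|lborel. norm (f k t)) \<le>
          (LINT t|lborel. norm (c k * of_real z ^ k) * norm (w t))" for k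
        using bound[of k] by (intro integral_mono integrable_norm f integrable_mult_right w) auto
      then show "\<exists>N. \<forall>k\<ge>N. norm (LINT t|lborel. norm (f k t)) \<le>
          norm (c k * of_real z ^ k) * (LINT t|lborel. norm (w t))"
        by (simp add: integral_nonneg)
      show "summable (\<lambda>k. norm (c k * of_real z ^ k) * (LINT t|lborel. norm (w t)))"
        using assms by (intro summable_mult2 abs) auto
    qed
  qed
  moreover have "integral\<^sup>L lborel (f k) = c k * of_real z ^ k * Beta (b + of_nat k) \<mu>" for k
  proof -
    have "f k t = c k * of_real z ^ k * (indicator {0<..<1} t *\<^sub>R
        (of_real t powr (b + of_nat k - 1) * of_real (1 - t) powr (\<mu> - 1)))" for t
    proof (cases "0 < t \<and> t < 1")
      case True
      then have "complex_of_real t powr (b + of_nat k - 1) = of_real t powr (b - 1) * of_real t ^ k"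
        by (simp add: powr_add powr_diff)
      then show ?thesis
        using True by (simp add: f_def w_def power_mult_distrib)
    qed (simp add: f_def w_def)
    then have "f k = (\<lambda>t. c k * of_real z ^ k * (indicator {0<..<1} t *\<^sub>R
        (of_real t powr (b + of_nat k - 1) * of_real (1 - t) powr (\<mu> - 1))))" ..
    then have "integral\<^sup>L lborel (f k) = c k * of_real z ^ k *
        (LINT t:{0<..<1}|lborel. of_real t powr (b + of_nat k - 1) * of_real (1 - t) powr (\<mu> - 1))"
      by (simp only: set_lebesgue_integral_def integral_mult_right_zero)
    moreover have "Re (b + of_nat k) > 0" using assms(1) by simp
    ultimately show ?thesis by (simp only: Beta_integral_complex assms(2))
  qed
  moreover have "(LINT t|lborel. (\<Sum>k. f k t)) =
      (LINT t:{0<..<1}|lborel. of_real t powr (b - 1) * of_real (1 - t) powr (\<mu> - 1) *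
       of_real (1 - z * t) powr (- a))"
    unfolding sums_unique[OF f_sums, symmetric] set_lebesgue_integral_def w_def by simp
  ultimately show ?thesis by (simp add: c_def)
qed

section \<open>Residues inside a loop around the natural numbers\<close>

lemma first_crossing:
  fixes f :: "real \<Rightarrow> real"
  assumes "continuous_on UNIV f" "f 0 < R" "filterlim f at_top at_top"
  obtains t where "t > 0" "f t = R" "\<And>s. 0 \<le> s \<Longrightarrow> s \<le> t \<Longrightarrow> f s \<le> R"
proof -
  have cont: "continuous_on S f" for S using assms(1) continuous_on_subset by blast
  have "\<forall>\<^sub>F t in at_top. f t \<ge> R \<and> t \<ge> 0"
    using assms(3) by (simp add: filterlim_at_top eventually_conj eventually_ge_at_top)
  then obtain T where T: "f T \<ge> R" "T \<ge> 0"
    by (metis (no_types, lifting) eventually_at_top_linorder order_refl)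
  \<comment> \<open>The times at which \<open>f\<close> is at least \<open>R\<close> form a compact
    set, which has a least element \<open>t\<close>. By the intermediate value theorem
    \<open>f\<close> takes the value \<open>R\<close> no later than \<open>t\<close>, hence exactly
    at \<open>t\<close>.\<close>
  have "compact ({0..T} \<inter> f -` {R..})"
    by (intro compact_Int_closed closed_vimage cont) auto
  then obtain t where t: "t \<in> {0..T} \<inter> f -` {R..}"
    and min: "\<And>s. s \<in> {0..T} \<inter> f -` {R..} \<Longrightarrow> t \<le> s"
    using T compact_attains_inf[of "{0..T} \<inter> f -` {R..}"]
    by (metis (no_types, lifting) IntI atLeastAtMost_iff atLeast_iff empty_iff order_refl vimageI)
  obtain s where s: "0 \<le> s" "s \<le> t" "f s = R"
    using IVT'[of f 0 R t] t assms(2) cont by auto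
  then have "s = t" using min[of s] t by auto
  have "f r \<le> R" if "0 \<le> r" "r \<le> t" for r
    using min[of r] that t s(3) \<open>s = t\<close> by (cases "r = t") force+
  moreover have "t > 0" using t assms(2) \<open>s = t\<close> s by (cases "t = 0") auto
  ultimately show thesis using that s(3) \<open>s = t\<close> by blast
qed

lemma closed_segment_Re_eq:
  assumes "z \<in> closed_segment u v" "Re u = R" "Re v = R"
  shows "Re z = R"
proof -
  obtain t where z: "z = (1 - t) *\<^sub>R u + t *\<^sub>R v" using assms by (auto simp: in_segment)
  show ?thesis unfolding z using assms(2,3) by (simp add: algebra_simps)
qed

lemma closed_segment_Im_eq:
  assumes "z \<in> closed_segment u v" "Im u = R" "Im v = R"
  shows "Im z = R"
proof -
  obtain t where z: "z = (1 - t) *\<^sub>R u + t *\<^sub>R v" using assms by (auto simp: in_segment)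
  show ?thesis unfolding z using assms(2,3) by (simp add: algebra_simps)
qed

text \<open>The sign conditions put the real axis strictly between the asymptotic heights of the
  loop, so that all large naturals lie between its two tails.\<close>

locale right_loop_around_nats =
  fixes g :: "real \<Rightarrow> complex" and c d :: real
  assumes loop: "right_loop c d g" and c_neg: "c < 0" and d_pos: "0 < d"
begin

text \<open>The bound on \<open>{S..T}\<close> keeps the arc, once closed up, in a half-plane
  bounded by the line of the closing segment. The signs of \<open>S\<close> and \<open>T\<close>
  tell which tail each end belongs to once \<open>R\<close> is large.\<close>

definition truncation :: "real \<Rightarrow> real \<Rightarrow> real \<Rightarrow> bool" where
  "truncation R S T \<longleftrightarrow> S < 0 \<and> 0 < T \<and> Re (g S) = R \<and> Re (g T) = R \<and>
     (\<forall>s\<in>{S..T}. Re (g s) \<le> R)"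

definition closed_arc :: "real \<Rightarrow> real \<Rightarrow> real \<Rightarrow> complex" where
  "closed_arc S T = subpath S T g +++ linepath (g T) (g S)"

lemma continuous_on_curve: "continuous_on A g"
proof -
  have "isCont g x" for x
  proof -
    have "g piecewise_C1_differentiable_on {x - 1..x + 1}"
      using loop by (auto simp: right_loop_def contour_curve_def)
    then have "continuous_on {x - 1..x + 1} g"
      by (simp add: piecewise_C1_differentiable_on_def)
    then show ?thesis
      by (rule continuous_on_interior) simp
  qed
  then show ?thesis by (simp add: continuous_at_imp_continuous_on)
qed

lemma continuous_on_Re_curve: "continuous_on A (\<lambda>s. Re (g s))"
  by (intro continuous_intros continuous_on_curve)

lemma truncation_exists:
  assumes "R > Re (g 0)"
  obtains S T where "truncation R S T"
proof -
  have lim: "filterlim (\<lambda>s. Re (g s)) at_top at_bot" "filterlim (\<lambda>s. Re (g s)) at_top at_top"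
    using loop by (auto simp: right_loop_def)
  obtain T where T: "T > 0" "Re (g T) = R" "\<And>s. 0 \<le> s \<Longrightarrow> s \<le> T \<Longrightarrow> Re (g s) \<le> R"
    using first_crossing[of "\<lambda>s. Re (g s)" R] assms lim continuous_on_Re_curve by auto
  have "continuous_on UNIV (\<lambda>s. Re (g (- s)))"
    by (intro continuous_intros continuous_on_compose2[OF continuous_on_curve]) auto
  moreover have "filterlim (\<lambda>s. Re (g (- s))) at_top at_top"
    using lim(1) by (simp add: filterlim_at_bot_mirror)
  ultimately obtain S where S: "S > 0" "Re (g (- S)) = R"
      "\<And>s. 0 \<le> s \<Longrightarrow> s \<le> S \<Longrightarrow> Re (g (- s)) \<le> R"
    using first_crossing[of "\<lambda>s. Re (g (- s))" R] assms by auto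
  have "Re (g s) \<le> R" if "s \<in> {- S..T}" for s
    using S(3)[of "- s"] T(3)[of s] that by (cases "s \<ge> 0") auto
  then show thesis
    using that[of "- S" T] S T by (auto simp: truncation_def)
qed

lemma path_subpath_curve: "path (subpath S T g)"
  unfolding path_def subpath_def
  by (rule continuous_on_compose2[OF continuous_on_curve[of UNIV]]) (auto intro!: continuous_intros)

lemma path_image_subpath_curve: "S \<le> T \<Longrightarrow> path_image (subpath S T g) = g ` {S..T}"
  by (simp add: path_image_subpath_gen closed_segment_eq_real_ivl)

lemma closed_arc_simps [simp]:
  "path (closed_arc S T)" "pathstart (closed_arc S T) = g S" "pathfinish (closed_arc S T) = g S"
  by (simp_all add: closed_arc_def path_subpath_curve)

lemma path_image_closed_arc:
  "S \<le> T \<Longrightarrow> path_image (closed_arc S T) = g ` {S..T} \<union> closed_segment (g T) (g S)"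
  by (simp add: closed_arc_def path_image_join path_image_subpath_curve)

lemma path_image_closed_arc_Re_le:
  assumes "truncation R S T" "z \<in> path_image (closed_arc S T)"
  shows "Re z \<le> R"
  using assms closed_segment_Re_eq[of z "g T" "g S" R]
  by (auto simp: truncation_def path_image_closed_arc)

lemma path_image_closed_arc_cases:
  assumes "truncation R S T" "z \<in> path_image (closed_arc S T)"
  obtains "z \<in> range g" | "Re z = R"
  using assms closed_segment_Re_eq[of z "g T" "g S" R]
  by (auto simp: truncation_def path_image_closed_arc)

section \<open>Winding numbers of the closed arc\<close>

lemma winding_number_beyond:
  assumes "truncation R S T" "R < Re z"
  shows "z \<notin> path_image (closed_arc S T)" "winding_number (closed_arc S T) z = 0"
proof -
  show "z \<notin> path_image (closed_arc S T)"
    using path_image_closed_arc_Re_le[OF assms(1), of z] assms(2) by auto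
  show "winding_number (closed_arc S T) z = 0"
    by (rule winding_number_zero_outside[OF _ convex_halfspace_Re_le[of R]])
      (use path_image_closed_arc_Re_le[OF assms(1)] assms(2) in auto)
qed

text \<open>Real parts are bounded on a compact parameter interval, so a point of the curve far to
  the right has a parameter of large modulus, where \<open>Im (g s)\<close> is close to its limit;
  the sign of the parameter selects the limit.\<close>

lemma tails:
  assumes "e > 0"
  obtains R\<^sub>0 where "\<And>s. R\<^sub>0 \<le> Re (g s) \<Longrightarrow> s < 0 \<Longrightarrow> \<bar>Im (g s) - c\<bar> < e"
    "\<And>s. R\<^sub>0 \<le> Re (g s) \<Longrightarrow> 0 \<le> s \<Longrightarrow> \<bar>Im (g s) - d\<bar> < e"
proof -
  have "\<forall>\<^sub>F s in at_bot. dist (Im (g s)) c < e" "\<forall>\<^sub>F s in at_top. dist (Im (g s)) d < e"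
    using loop assms by (auto simp: right_loop_def tendsto_iff)
  then obtain A B where A: "\<And>s. s \<le> A \<Longrightarrow> dist (Im (g s)) c < e"
    and B: "\<And>s. s \<ge> B \<Longrightarrow> dist (Im (g s)) d < e"
    by (auto simp: eventually_at_bot_linorder eventually_at_top_linorder)
  have "compact ((\<lambda>s. Re (g s)) ` {min A 0..max B 0})"
    by (intro compact_continuous_image continuous_on_Re_curve) auto
  then have "bounded ((\<lambda>s. Re (g s)) ` {min A 0..max B 0})" by (rule compact_imp_bounded)
  then obtain R where R: "\<And>s. s \<in> {min A 0..max B 0} \<Longrightarrow> \<bar>Re (g s)\<bar> \<le> R"
    unfolding bounded_iff by (metis image_eqI real_norm_def)
  have out: "s \<notin> {min A 0..max B 0}" if "R + 1 \<le> Re (g s)" for s using R[of s] that by auto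
  show thesis
  proof (rule that[of "R + 1"])
    fix s assume s: "R + 1 \<le> Re (g s)"
    show "\<bar>Im (g s) - c\<bar> < e" if "s < 0"
      using A[of s] out[OF s] that by (auto simp: dist_real_def)
    show "\<bar>Im (g s) - d\<bar> < e" if "0 \<le> s"
      using B[of s] out[OF s] that by (auto simp: dist_real_def)
  qed
qed

text \<open>
  The closing segment is one side of a rectangle around \<open>p\<close>. Replacing it by the other three
  sides gives a loop that no longer winds around \<open>p\<close>, because it misses the ray from \<open>p\<close> to the right.
\<close>

lemma winding_number_between_tails:
  assumes e: "e > 0"
    and tail1: "\<And>s. R\<^sub>0 \<le> Re (g s) \<Longrightarrow> s < 0 \<Longrightarrow> \<bar>Im (g s) - c\<bar> < e"
    and tail2: "\<And>s. R\<^sub>0 \<le> Re (g s) \<Longrightarrow> 0 \<le> s \<Longrightarrow> \<bar>Im (g s) - d\<bar> < e"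
    and trunc: "truncation R S T"
    and p: "R\<^sub>0 < Re p" "Re p < R" "c + e < Im p" "Im p < d - e"
  shows "p \<notin> path_image (closed_arc S T)" "winding_number (closed_arc S T) p = - 1"
proof -
  have ST: "S < 0" "0 < T" "Re (g S) = R" "Re (g T) = R" "\<And>s. s \<in> {S..T} \<Longrightarrow> Re (g s) \<le> R"
    using trunc by (auto simp: truncation_def)
  have ends: "\<bar>Im (g S) - c\<bar> < e" "\<bar>Im (g T) - d\<bar> < e"
    using tail1[of S] tail2[of T] ST p by auto
  have ray: "z \<notin> range g" if "Im z = Im p" "R\<^sub>0 < Re z" for z
  proof
    assume "z \<in> range g"
    then obtain s where "z = g s" by auto
    then show False using tail1[of s] tail2[of s] that p by (cases "s < 0") auto
  qed
  define a\<^sub>1 a\<^sub>4 where "a\<^sub>1 = Complex R\<^sub>0 (Im (g S))" and "a\<^sub>4 = Complex R\<^sub>0 (Im (g T))"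
  define D where "D = linepath (g T) a\<^sub>4 +++ linepath a\<^sub>4 a\<^sub>1 +++ linepath a\<^sub>1 (g S)"
  have a: "Re a\<^sub>1 = R\<^sub>0" "Re a\<^sub>4 = R\<^sub>0" "Im a\<^sub>1 = Im (g S)" "Im a\<^sub>4 = Im (g T)"
    by (simp_all add: a\<^sub>1_def a\<^sub>4_def)
  have seg: "Re z = Re u" if "z \<in> closed_segment u v" "Re u = Re v" for z u v
    using that closed_segment_Re_eq by metis
  have segI: "Im z = Im u" if "z \<in> closed_segment u v" "Im u = Im v" for z u v
    using that closed_segment_Im_eq by metis
  have segR: "Re z \<le> R" if "z \<in> closed_segment u v" "Re u \<le> R" "Re v \<le> R" for z u v
  proof -
    have "closed_segment u v \<subseteq> {z. Re z \<le> R}"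
      by (rule closed_segment_subset) (use that convex_halfspace_Re_le in auto)
    then show ?thesis using that by auto
  qed
  have ne: "Im p \<noteq> Im (g S)" "Im p \<noteq> Im (g T)" using ends p by auto
  have avoid: "z \<notin> closed_segment (g T) a\<^sub>4" "z \<notin> closed_segment a\<^sub>4 a\<^sub>1"
    "z \<notin> closed_segment a\<^sub>1 (g S)" "z \<notin> g ` {S..T}"
    if "Im z = Im p" "R\<^sub>0 < Re z" for z
    using seg[of z a\<^sub>4 a\<^sub>1] segI[of z "g T" a\<^sub>4] segI[of z a\<^sub>1 "g S"] ray[OF that] that ne a by auto
  have "Re p \<noteq> R" using p by simp
  then have avoid': "p \<notin> closed_segment (g T) (g S)"
    using seg[of p "g T" "g S"] ST by auto
  show notin: "p \<notin> path_image (closed_arc S T)"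
    using avoid[of p] avoid' ST p by (simp add: path_image_closed_arc)
  have rect: "rectpath a\<^sub>1 (g T) = linepath a\<^sub>1 (g S) +++ linepath (g S) (g T) +++
      linepath (g T) a\<^sub>4 +++ linepath a\<^sub>4 a\<^sub>1"
    using ST by (simp add: rectpath_def Let_def a\<^sub>1_def a\<^sub>4_def complex_eq_iff)
      (metis complex_surj)
  \<comment> \<open>The tail bounds put \<open>g S\<close> below \<open>p\<close> and
    \<open>g T\<close> above it, so \<open>a\<^sub>1\<close> is the lower left and
    \<open>g T\<close> the upper right corner of a rectangle with \<open>p\<close> inside.\<close>
  have "winding_number (rectpath a\<^sub>1 (g T)) p = 1"
    by (rule winding_number_rectpath) (use p ends ST in \<open>auto simp: in_box_complex_iff a\<close>)
  then have 1: "winding_number (linepath a\<^sub>1 (g S)) p + winding_number (linepath (g S) (g T)) p +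
      winding_number (linepath (g T) a\<^sub>4) p + winding_number (linepath a\<^sub>4 a\<^sub>1) p = 1"
    using avoid[of p] avoid' p unfolding rect
    by (simp add: winding_number_join path_image_join closed_segment_commute add.assoc)
  have 2: "winding_number (linepath (g S) (g T)) p = - winding_number (linepath (g T) (g S)) p"
    using winding_number_reversepath[of "linepath (g T) (g S)" p] avoid' by simp
  have 3: "winding_number (subpath S T g +++ D) p = 0"
  proof -
    have im: "path_image (subpath S T g +++ D) = g ` {S..T} \<union> closed_segment (g T) a\<^sub>4 \<union>
        closed_segment a\<^sub>4 a\<^sub>1 \<union> closed_segment a\<^sub>1 (g S)"
      using ST by (auto simp: D_def path_image_join path_image_subpath_curve)
    have path: "path (subpath S T g +++ D)" "pathfinish (subpath S T g +++ D) = pathstart (subpath S T g +++ D)"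
      by (simp_all add: D_def path_subpath_curve)
    \<comment> \<open>The segment from \<open>p\<close> to \<open>q\<close> runs between the tails
      and to the right of the left side, so it misses the whole loop; \<open>q\<close> lies outside
      the half-plane that contains the loop.\<close>
    define q where "q = Complex (R + 1) (Im p)"
    have "winding_number (subpath S T g +++ D) p = winding_number (subpath S T g +++ D) q"
    proof (rule winding_number_eq[OF path])
      show "p \<in> closed_segment p q" "q \<in> closed_segment p q" "connected (closed_segment p q)" by auto
      have "Im z = Im p \<and> R\<^sub>0 < Re z" if "z \<in> closed_segment p q" for z
      proof
        show "Im z = Im p" using segI[OF that] by (simp add: q_def)
        have "closed_segment p q \<subseteq> {z. Re z > R\<^sub>0}"
          by (rule closed_segment_subset) (use p convex_halfspace_Re_gt in \<open>auto simp: q_def\<close>)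
        then show "R\<^sub>0 < Re z" using that by auto
      qed
      then show "closed_segment p q \<inter> path_image (subpath S T g +++ D) = {}"
        unfolding im using avoid by blast
    qed
    also have "\<dots> = 0"
    proof (rule winding_number_zero_outside[OF path(1) convex_halfspace_Re_le[of R] path(2)])
      show "q \<notin> {x. Re x \<le> R}" by (simp add: q_def)
      show "path_image (subpath S T g +++ D) \<subseteq> {x. Re x \<le> R}"
        unfolding im using ST segR p a by force
    qed
    finally show ?thesis .
  qed
  have 4: "p \<notin> path_image (subpath S T g)"
    using avoid(4)[of p] p ST by (simp add: path_image_subpath_curve)
  have 5: "winding_number (subpath S T g) p + winding_number (linepath (g T) a\<^sub>4) p +
      winding_number (linepath a\<^sub>4 a\<^sub>1) p + winding_number (linepath a\<^sub>1 (g S)) p = 0"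
    using 3 4 avoid[of p] p unfolding D_def
    by (simp add: winding_number_join path_image_join path_subpath_curve add.assoc)
  \<comment> \<open>The closed arc is the deformed loop minus the rectangle: the three auxiliary
    sides cancel and 0 - 1 remains.\<close>
  have "winding_number (closed_arc S T) p =
      winding_number (subpath S T g) p + winding_number (linepath (g T) (g S)) p"
    unfolding closed_arc_def
    by (rule winding_number_join) (use 4 avoid' in \<open>auto simp: path_subpath_curve\<close>)
  also have "\<dots> = (winding_number (subpath S T g) p + winding_number (linepath (g T) a\<^sub>4) p +
      winding_number (linepath a\<^sub>4 a\<^sub>1) p + winding_number (linepath a\<^sub>1 (g S)) p) -
      (winding_number (linepath a\<^sub>1 (g S)) p + winding_number (linepath (g S) (g T)) p +
      winding_number (linepath (g T) a\<^sub>4) p + winding_number (linepath a\<^sub>4 a\<^sub>1) p)"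
    unfolding 2 by simp
  also have "\<dots> = - 1" unfolding 1 5 by simp
  finally show "winding_number (closed_arc S T) p = - 1" .
qed

text \<open>The closing segment cannot meet a compact path once it lies far enough to the right.\<close>

lemma winding_number_eq_of_connected_component:
  assumes "connected_component (- range g) p q"
  shows "\<forall>\<^sub>F R in at_top. \<forall>S T. truncation R S T \<longrightarrow> p \<notin> path_image (closed_arc S T) \<and>
    winding_number (closed_arc S T) p = winding_number (closed_arc S T) q"
proof -
  \<comment> \<open>The curve tends to infinity at both ends, so only a compact arc of it comes near
    a given point. Hence the range is closed, its complement is open, and connected components of
    the complement are path components.\<close>
  have "closed (range g)"
  proof (rule closure_subset_eq[THEN iffD1], rule subsetI)
    fix y assume y: "y \<in> closure (range g)"
    have "\<forall>\<^sub>F s in at_bot. Re y + 1 \<le> Re (g s)" "\<forall>\<^sub>F s in at_top. Re y + 1 \<le> Re (g s)"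
      using loop by (auto simp: right_loop_def filterlim_at_top)
    then obtain A B where AB: "\<And>s. s \<le> A \<Longrightarrow> Re y + 1 \<le> Re (g s)" "\<And>s. s \<ge> B \<Longrightarrow> Re y + 1 \<le> Re (g s)"
      by (auto simp: eventually_at_bot_linorder eventually_at_top_linorder)
    have "range g \<subseteq> g ` {A..B} \<union> {z. Re z \<ge> Re y + 1}"
      using AB by (auto simp: not_le) (meson atLeastAtMost_iff imageI linorder_le_cases)
    moreover have "closed (g ` {A..B} \<union> {z. Re z \<ge> Re y + 1})"
      by (intro closed_Un compact_imp_closed compact_continuous_image continuous_on_curve
          closed_halfspace_Re_ge) auto
    ultimately have "y \<in> g ` {A..B} \<union> {z. Re z \<ge> Re y + 1}"
      using y closure_minimal by blast
    then show "y \<in> range g" by auto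
  qed
  then have "open (- range g)" by (simp add: open_Compl)
  then have "path_component (- range g) p q"
    using assms by (simp add: path_component_eq_connected_component open_imp_locally_path_connected)
  then obtain h where h: "path h" "path_image h \<subseteq> - range g" "pathstart h = p" "pathfinish h = q"
    by (auto simp: path_component_def)
  obtain M where M: "\<And>z. z \<in> path_image h \<Longrightarrow> norm z \<le> M"
    using bounded_path_image[OF h(1)] by (auto simp: bounded_iff)
  show ?thesis
  proof (rule eventually_mono[OF eventually_gt_at_top[of M]], intro allI impI)
    fix R S T assume R: "M < R" and trunc: "truncation R S T"
    have disj: "path_image h \<inter> path_image (closed_arc S T) = {}"
    proof (rule ccontr)
      assume "\<not> ?thesis"
      then obtain z where z: "z \<in> path_image h" "z \<in> path_image (closed_arc S T)" by auto
      have "Re z < R" using M[OF z(1)] complex_Re_le_cmod[of z] R by simp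
      then show False using path_image_closed_arc_cases[OF trunc z(2)] z(1) h(2) by auto
    qed
    moreover have "p \<in> path_image h" "q \<in> path_image h" using h by auto
    ultimately show "p \<notin> path_image (closed_arc S T) \<and>
        winding_number (closed_arc S T) p = winding_number (closed_arc S T) q"
      using winding_number_eq[of "closed_arc S T" p "path_image h" q] h(1)
      by (auto simp: connected_path_image)
  qed
qed

text \<open>Naturals beyond \<open>R\<^sub>0\<close> and left of the line lie between the tails.
  Each of the finitely many others is joined, off the curve, to a far point of the midline, which
  does lie between the tails; finiteness makes one threshold for \<open>R\<close> serve them
  all.\<close>

lemma winding_number_nat:
  assumes nats: "range of_nat \<subseteq> side_of g (\<lambda>r. Complex r ((c + d) / 2))"
  shows "\<forall>\<^sub>F R in at_top. \<forall>S T. truncation R S T \<longrightarrow> (\<forall>k::nat. real k \<noteq> R \<longrightarrow>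
    of_nat k \<notin> path_image (closed_arc S T) \<and>
    winding_number (closed_arc S T) (of_nat k) = (if real k < R then - 1 else 0))"
proof -
  \<comment> \<open>Half the smaller distance of the real axis to the heights \<open>c\<close> and
    \<open>d\<close>: both the real axis and the midline then stay more than \<open>e\<close> away
    from these heights.\<close>
  define e where "e = min (- c) d / 2"
  have e: "e > 0" "c + e < 0" "0 < d - e" "c + e < (c + d) / 2" "(c + d) / 2 < d - e"
    using c_neg d_pos by (auto simp: e_def min_def)
  obtain R\<^sub>0 where tails: "\<And>s. R\<^sub>0 \<le> Re (g s) \<Longrightarrow> s < 0 \<Longrightarrow> \<bar>Im (g s) - c\<bar> < e"
      "\<And>s. R\<^sub>0 \<le> Re (g s) \<Longrightarrow> 0 \<le> s \<Longrightarrow> \<bar>Im (g s) - d\<bar> < e"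
    using tails[OF e(1)] by blast
  have "\<forall>\<^sub>F R in at_top. \<forall>S T. truncation R S T \<longrightarrow> of_nat k \<notin> path_image (closed_arc S T) \<and>
      winding_number (closed_arc S T) (of_nat k) = - 1" for k :: nat
  proof -
    have "of_nat k \<in> side_of g (\<lambda>r. Complex r ((c + d) / 2))" using nats by auto
    then have "\<forall>\<^sub>F r in at_top. connected_component (- range g) (of_nat k) (Complex r ((c + d) / 2))"
      by (simp add: side_of_def)
    then have "\<forall>\<^sub>F r in at_top. R\<^sub>0 < r \<and>
        connected_component (- range g) (of_nat k) (Complex r ((c + d) / 2))"
      using eventually_conj[OF eventually_gt_at_top] by blast
    then obtain r where r: "R\<^sub>0 < r"
      "connected_component (- range g) (of_nat k) (Complex r ((c + d) / 2))"
      by (metis (no_types, lifting) eventually_at_top_linorder order_refl)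
    show ?thesis
      using winding_number_eq_of_connected_component[OF r(2)] eventually_gt_at_top[of r]
    proof eventually_elim
      case (elim R)
      then show ?case
        using winding_number_between_tails(2)[OF e(1) tails, where R = R and p = "Complex r ((c + d) / 2)"] r e
        by auto
    qed
  qed
  then have "\<forall>\<^sub>F R in at_top. \<forall>k\<in>{k. real k \<le> R\<^sub>0}. \<forall>S T. truncation R S T \<longrightarrow>
      of_nat k \<notin> path_image (closed_arc S T) \<and> winding_number (closed_arc S T) (of_nat k) = - 1"
    by (intro eventually_ball_finite finite_nat_set_iff_bounded_le[THEN iffD2] exI[of _ "nat \<lceil>R\<^sub>0\<rceil>"])
      (auto, linarith)
  then show ?thesis
    using eventually_gt_at_top[of R\<^sub>0]
  proof eventually_elim
    case (elim R)
    show ?case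
    proof (intro allI impI)
      fix S T k assume trunc: "truncation R S T" and k: "real k \<noteq> R"
      consider "real k \<le> R\<^sub>0" | "R\<^sub>0 < real k" "real k < R" | "R < real k" using k by linarith
      then show "of_nat k \<notin> path_image (closed_arc S T) \<and>
        winding_number (closed_arc S T) (of_nat k) = (if real k < R then - 1 else 0)"
      proof cases
        case 1 then show ?thesis using elim trunc by auto
      next
        case 2 then show ?thesis
          using winding_number_between_tails[OF e(1) tails trunc, where p = "of_nat k"] e by auto
      next
        case 3 then show ?thesis
          using winding_number_beyond[OF trunc, of "of_nat k"] by auto
      qed
    qed
  qed
qed

text \<open>The real part is bounded below along the curve, so every closed arc lies in one fixed
  right half-plane and does not wind around points to its left. By \<open>fin\<close> only finitely
  many points of \<open>Q\<close> remain, and each is joined to such a point off the curve.\<close>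

lemma winding_number_left:
  assumes Q: "Q \<subseteq> side_of g (\<lambda>r. Complex (- r) 0)"
    and fin: "\<And>M. finite {q \<in> Q. M \<le> Re q}"
  shows "\<forall>\<^sub>F R in at_top. \<forall>S T. truncation R S T \<longrightarrow> (\<forall>q\<in>Q.
    q \<notin> path_image (closed_arc S T) \<and> winding_number (closed_arc S T) q = 0)"
proof -
  have "\<forall>\<^sub>F s in at_bot. 0 \<le> Re (g s)" "\<forall>\<^sub>F s in at_top. 0 \<le> Re (g s)"
    using loop by (auto simp: right_loop_def filterlim_at_top)
  then obtain A B where AB: "\<And>s. s \<le> A \<Longrightarrow> 0 \<le> Re (g s)" "\<And>s. s \<ge> B \<Longrightarrow> 0 \<le> Re (g s)"
    by (auto simp: eventually_at_bot_linorder eventually_at_top_linorder)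
  have "compact ((\<lambda>s. Re (g s)) ` {A..B})"
    by (intro compact_continuous_image continuous_on_Re_curve) auto
  then have "bounded ((\<lambda>s. Re (g s)) ` {A..B})" by (rule compact_imp_bounded)
  then obtain C where C: "\<And>s. s \<in> {A..B} \<Longrightarrow> \<bar>Re (g s)\<bar> \<le> C"
    unfolding bounded_iff by (metis image_eqI real_norm_def)
  have Re_ge: "- \<bar>C\<bar> \<le> Re (g s)" for s
    using AB[of s] C[of s] by (cases "s \<le> A"; cases "s \<ge> B") auto
  have arc: "path_image (closed_arc S T) \<subseteq> {z. - \<bar>C\<bar> \<le> Re z}" if "truncation R S T" for R S T
  proof -
    have "closed_segment (g T) (g S) \<subseteq> {z. - \<bar>C\<bar> \<le> Re z}"
      by (rule closed_segment_subset) (use Re_ge in \<open>auto intro: convex_halfspace_Re_ge\<close>)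
    then show ?thesis using that Re_ge by (auto simp: path_image_closed_arc truncation_def)
  qed
  have left: "z \<notin> path_image (closed_arc S T) \<and> winding_number (closed_arc S T) z = 0"
    if "truncation R S T" "Re z < - \<bar>C\<bar>" for R S T z
    using winding_number_zero_outside[of "closed_arc S T" "{z. - \<bar>C\<bar> \<le> Re z}" z]
      arc[OF that(1)] that(2) convex_halfspace_Re_ge by auto
  have "\<forall>\<^sub>F R in at_top. \<forall>S T. truncation R S T \<longrightarrow>
      q \<notin> path_image (closed_arc S T) \<and> winding_number (closed_arc S T) q = 0" if "q \<in> Q" for q
  proof -
    have "\<forall>\<^sub>F r in at_top. connected_component (- range g) q (Complex (- r) 0)"
      using Q that by (auto simp: side_of_def)
    then have "\<forall>\<^sub>F r in at_top. \<bar>C\<bar> < r \<and> connected_component (- range g) q (Complex (- r) 0)"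
      using eventually_conj[OF eventually_gt_at_top] by blast
    then obtain r where r: "\<bar>C\<bar> < r" "connected_component (- range g) q (Complex (- r) 0)"
      by (metis (no_types, lifting) eventually_at_top_linorder order_refl)
    show ?thesis
      using winding_number_eq_of_connected_component[OF r(2)]
    proof eventually_elim
      case (elim R)
      then show ?case using left[of R _ _ "Complex (- r) 0"] r by auto
    qed
  qed
  then have "\<forall>\<^sub>F R in at_top. \<forall>q\<in>{q \<in> Q. - \<bar>C\<bar> \<le> Re q}. \<forall>S T. truncation R S T \<longrightarrow>
      q \<notin> path_image (closed_arc S T) \<and> winding_number (closed_arc S T) q = 0"
    by (intro eventually_ball_finite fin) auto
  then show ?thesis
  proof eventually_elim
    case (elim R)
    then show ?case using left[of R] by (metis (mono_tags, lifting) mem_Collect_eq not_le)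
  qed
qed

section \<open>The residue theorem on truncated loops\<close>

lemma valid_path_subpath_curve:
  assumes "S < T"
  shows "valid_path (subpath S T g)"
proof -
  have "g \<circ> (\<lambda>x. (T - S) * x + S) piecewise_C1_differentiable_on {0..1}"
  proof (rule piecewise_C1_differentiable_compose)
    show "(\<lambda>x. (T - S) * x + S) piecewise_C1_differentiable_on {0..1}"
      by (simp add: C1_differentiable_imp_piecewise)
    have "(\<lambda>x. (T - S) * x + S) ` {0..1} = {S..T}"
      using assms by (simp add: image_affinity_atLeastAtMost)
    then show "g piecewise_C1_differentiable_on (\<lambda>x. (T - S) * x + S) ` {0..1}"
      using loop by (simp add: right_loop_def contour_curve_def)
    show "finite ({0..1} \<inter> (\<lambda>x. (T - S) * x + S) -` {x})" for x
      using assms by (simp add: Int_commute [of "{0..1}"] inj_on_def crossproduct_eq finite_vimage_IntI)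
  qed
  then show ?thesis by (auto simp: o_def valid_path_def subpath_def)
qed

text \<open>Links the Lebesgue integral over the parameter, in which the contours are given, to the
  contour integral of the residue theorem. The affine map from the unit interval rescales the
  derivative, except at the finitely many break points of the curve, which do not affect the
  integral.\<close>

lemma contour_integral_subpath_curve:
  assumes "S < T" and f: "f contour_integrable_on subpath S T g"
    and int: "set_integrable lborel {S..T} (line_integrand g f)"
  shows "contour_integral (subpath S T g) f = (LINT s:{S..T}|lborel. line_integrand g f s)"
proof -
  let ?I = "LINT s:{S..T}|lborel. line_integrand g f s"
  have "(line_integrand g f has_integral ?I) (cbox S T)"
    using set_borel_integral_eq_integral[OF int] by (simp add: has_integral_integral)
  from has_integral_affinity[OF this, of "T - S" S]
  have "((\<lambda>x. line_integrand g f ((T - S) * x + S)) has_integral ((1 / (T - S)) *\<^sub>R ?I)) {0..1}"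
    using assms(1) diff_divide_distrib[of T S "T - S"]
    by (simp add: image_affinity_atLeastAtMost_div_diff scaleR_conv_of_real)
  from has_integral_cmul[OF this, of "T - S"]
  have 1: "((\<lambda>x. (T - S) *\<^sub>R line_integrand g f ((T - S) * x + S)) has_integral ?I) {0..1}"
    using assms(1) by simp
  have "g piecewise_C1_differentiable_on {S..T}"
    using loop by (simp add: right_loop_def contour_curve_def)
  then obtain A where A: "\<And>x. x \<in> {S..T} - A \<Longrightarrow> g differentiable at x" "finite A"
    unfolding piecewise_C1_differentiable_on_def C1_differentiable_on_eq by blast
  let ?A = "(\<lambda>t. (T - S) * t + S) -` A"
  have vd: "vector_derivative (subpath S T g) (at x) =
      (T - S) *\<^sub>R vector_derivative g (at ((T - S) * x + S))"
    if "x \<in> {0..1}" "x \<notin> ?A" for x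
    unfolding subpath_def
  proof (rule vector_derivative_at [OF vector_diff_chain_at [simplified o_def]])
    show "((\<lambda>x. (T - S) * x + S) has_vector_derivative T - S) (at x)"
      by (intro derivative_eq_intros | simp)+
    have "(T - S) * x \<le> (T - S) * 1"
      using that assms(1) by (intro mult_left_mono) auto
    then have "(T - S) * x + S \<le> T" by (simp only: mult_1_right le_diff_eq)
    moreover have "0 \<le> (T - S) * x" using that assms(1) by simp
    ultimately have "(T - S) * x + S \<in> {S..T}" by simp
    then show "(g has_vector_derivative vector_derivative g (at ((T - S) * x + S))) (at ((T - S) * x + S))"
      using A(1)[of "(T - S) * x + S"] that by (simp add: vector_derivative_works)
  qed
  have "finite ?A"
    using A(2) assms(1) by (intro finite_vimageI) (auto simp: inj_on_def)
  then have "((\<lambda>x. f (subpath S T g x) * vector_derivative (subpath S T g) (at x)) has_integral ?I) {0..1}"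
    by (rule has_integral_spike_finite[OF _ _ 1])
      (use vd in \<open>auto simp: line_integrand_def subpath_def scaleR_conv_of_real\<close>)
  then show ?thesis
    by (intro contour_integral_unique) (simp add: has_contour_integral)
qed

text \<open>The residue theorem is applied with finitely many singularities, so it is used inside a
  ball around the closed arc. Among the singularities there, only the naturals up to
  \<open>N\<close> have nonzero winding number.\<close>

lemma contour_integral_closed_arc:
  assumes trunc: "truncation (real N + 1 / 2) S T"
    and holo: "f holomorphic_on - (range of_nat \<union> Q)"
    and fin: "\<And>M. finite {q \<in> Q. M \<le> Re q}"
    and nats: "\<And>k. of_nat k \<notin> path_image (closed_arc S T)"
      "\<And>k. winding_number (closed_arc S T) (of_nat k) = (if k \<le> N then - 1 else 0)"
    and Q: "\<And>q. q \<in> Q \<Longrightarrow> q \<notin> path_image (closed_arc S T)"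
      "\<And>q. q \<in> Q \<Longrightarrow> winding_number (closed_arc S T) q = 0"
    and int: "integrable lborel (line_integrand g f)"
  shows "(LINT s:{S..T}|lborel. line_integrand g f s) + contour_integral (linepath (g T) (g S)) f =
      - (2 * pi * \<i> * (\<Sum>k\<le>N. residue f (of_nat k)))"
    and "f contour_integrable_on linepath (g T) (g S)"
proof -
  have ST: "S < T" using trunc by (auto simp: truncation_def)
  obtain M where M: "\<And>z. z \<in> path_image (closed_arc S T) \<Longrightarrow> norm z \<le> M"
    using bounded_path_image[of "closed_arc S T"] by (auto simp: bounded_iff)
  \<comment> \<open>Larger than \<open>M\<close>, so that the ball contains the arc, and larger than
    \<open>N\<close>, so that it contains every natural with a nonzero winding number.\<close>
  define \<rho> where "\<rho> = max M N + 1"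
  define P where "P = (range of_nat \<union> Q) \<inter> ball 0 \<rho>"
  have finP: "finite P"
  proof (rule finite_subset)
    show "P \<subseteq> of_nat ` {..nat \<lceil>\<rho>\<rceil>} \<union> {q \<in> Q. - \<rho> \<le> Re q}"
    proof
      fix z assume z: "z \<in> P"
      then have "norm z < \<rho>" by (simp add: P_def)
      then have "- \<rho> \<le> Re z" using abs_Re_le_cmod[of z] by linarith
      moreover have "z \<in> of_nat ` {..nat \<lceil>\<rho>\<rceil>}" if "z = of_nat k" for k
        using that \<open>norm z < \<rho>\<close> by (auto intro!: imageI) linarith
      ultimately show "z \<in> of_nat ` {..nat \<lceil>\<rho>\<rceil>} \<union> {q \<in> Q. - \<rho> \<le> Re q}"
        using z by (auto simp: P_def)
    qed
  qed (simp add: fin)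
  have arc: "path_image (closed_arc S T) \<subseteq> ball 0 \<rho> - P"
  proof
    fix z assume z: "z \<in> path_image (closed_arc S T)"
    then have "norm z < \<rho>" using M[OF z] by (simp add: \<rho>_def)
    moreover have "z \<notin> P" using z nats(1) Q(1) by (auto simp: P_def)
    ultimately show "z \<in> ball 0 \<rho> - P" by simp
  qed
  have holo': "f holomorphic_on ball 0 \<rho> - P"
    by (rule holomorphic_on_subset[OF holo]) (auto simp: P_def)
  have valid: "valid_path (closed_arc S T)"
    unfolding closed_arc_def by (rule valid_path_join) (auto simp: valid_path_subpath_curve ST)
  have residues: "contour_integral (closed_arc S T) f =
      2 * pi * \<i> * (\<Sum>p\<in>P. winding_number (closed_arc S T) p * residue f p)"
  proof (rule Residue_theorem[OF open_ball connected_ball finP holo' valid _ arc])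
    show "\<forall>z. z \<notin> ball 0 \<rho> \<longrightarrow> winding_number (closed_arc S T) z = 0"
      using winding_number_zero_outside[of "closed_arc S T" "ball 0 \<rho>"] arc by auto
  qed simp
  have "(\<Sum>p\<in>P. winding_number (closed_arc S T) p * residue f p) =
      (\<Sum>p\<in>of_nat ` {..N}. winding_number (closed_arc S T) p * residue f p)"
  proof (rule sum.mono_neutral_right[OF finP])
    show "of_nat ` {..N} \<subseteq> P" by (auto simp: P_def \<rho>_def)
    show "\<forall>p\<in>P - of_nat ` {..N}. winding_number (closed_arc S T) p * residue f p = 0"
      using nats(2) Q(2) by (auto simp: P_def)
  qed
  also have "\<dots> = (\<Sum>k\<le>N. winding_number (closed_arc S T) (of_nat k) * residue f (of_nat k))"
    by (subst sum.reindex) (auto simp: inj_on_def)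
  also have "\<dots> = - (\<Sum>k\<le>N. residue f (of_nat k))"
    unfolding sum_negf[symmetric] by (intro sum.cong) (auto simp: nats(2))
  finally have sum: "(\<Sum>p\<in>P. winding_number (closed_arc S T) p * residue f p) =
    - (\<Sum>k\<le>N. residue f (of_nat k))" .
  have op: "open (ball 0 \<rho> - P)" using finP by (intro open_Diff finite_imp_closed) auto
  have sub: "f contour_integrable_on subpath S T g"
    by (rule contour_integrable_holomorphic_simple[OF holo' op])
      (use arc ST in \<open>auto simp: valid_path_subpath_curve path_image_closed_arc path_image_subpath_curve\<close>)
  show lin: "f contour_integrable_on linepath (g T) (g S)"
    by (rule contour_integrable_holomorphic_simple[OF holo' op])
      (use arc ST in \<open>auto simp: path_image_closed_arc\<close>)
  have "set_integrable lborel {S..T} (line_integrand g f)"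
    using int unfolding set_integrable_def by (intro integrable_mult_indicator) auto
  then have "contour_integral (subpath S T g) f = (LINT s:{S..T}|lborel. line_integrand g f s)"
    by (rule contour_integral_subpath_curve[OF ST sub])
  then show "(LINT s:{S..T}|lborel. line_integrand g f s) + contour_integral (linepath (g T) (g S)) f =
      - (2 * pi * \<i> * (\<Sum>k\<le>N. residue f (of_nat k)))"
    using residues sub lin ST unfolding closed_arc_def[of S T] sum[unfolded closed_arc_def[of S T]]
    by (simp add: valid_path_subpath_curve)
qed

text \<open>The truncated integrals tend to the line integral by dominated convergence. The closing
  segments have bounded length, since the two tails approach fixed heights, so decay of
  \<open>f\<close> on bounded pieces of the lines Re z = N + 1/2 suffices to make their contribution
  vanish.\<close>

theorem residue_sums:
  assumes nats: "range of_nat \<subseteq> side_of g (\<lambda>r. Complex r ((c + d) / 2))"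
    and Q: "Q \<subseteq> side_of g (\<lambda>r. Complex (- r) 0)"
    and fin: "\<And>M. finite {q \<in> Q. M \<le> Re q}"
    and holo: "f holomorphic_on - (range of_nat \<union> Q)"
    and int: "integrable lborel (line_integrand g f)"
    and decay: "\<And>K. \<exists>B. B \<longlonglongrightarrow> 0 \<and> (\<forall>\<^sub>F N in sequentially.
      \<forall>z. Re z = real N + 1 / 2 \<and> \<bar>Im z\<bar> \<le> K \<longrightarrow> norm (f z) \<le> B N)"
  shows "(\<lambda>k. residue f (of_nat k)) sums (- line_integral g f / (2 * pi * \<i>))"
proof -
  have "\<forall>N. \<exists>S T. real N + 1 / 2 > Re (g 0) \<longrightarrow> truncation (real N + 1 / 2) S T"
    using truncation_exists by metis
  then obtain S T where ST: "\<And>N. real N + 1 / 2 > Re (g 0) \<Longrightarrow> truncation (real N + 1 / 2) (S N) (T N)"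
    by metis
  have lim: "filterlim (\<lambda>N. real N + 1 / 2) at_top sequentially"
    by (rule filterlim_at_top_mono[OF filterlim_real_sequentially]) auto
  have ev: "\<forall>\<^sub>F N in sequentially. P (real N + 1 / 2)" if "\<forall>\<^sub>F R in at_top. P R" for P
    using that lim by (simp add: filterlim_iff)
  have trunc: "\<forall>\<^sub>F N in sequentially. truncation (real N + 1 / 2) (S N) (T N)"
    using ev[OF eventually_gt_at_top[of "Re (g 0)"]] by eventually_elim (rule ST)
  \<comment> \<open>On \<open>{- B..B}\<close> the real part of the curve is bounded, so end points
    with a larger real part have parameters outside this interval.\<close>
  have exhaust: "\<forall>\<^sub>F N in sequentially. S N < - B \<and> B < T N" for B
  proof -
    have "compact ((\<lambda>s. Re (g s)) ` {- B..B})"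
      by (intro compact_continuous_image continuous_on_Re_curve) auto
    then have "bounded ((\<lambda>s. Re (g s)) ` {- B..B})" by (rule compact_imp_bounded)
    then obtain C where C: "\<And>s. s \<in> {- B..B} \<Longrightarrow> \<bar>Re (g s)\<bar> \<le> C"
      unfolding bounded_iff by (metis image_eqI real_norm_def)
    show ?thesis
      using trunc ev[OF eventually_gt_at_top[of C]]
    proof eventually_elim
      case (elim N)
      then have "S N < 0" "0 < T N" "S N \<notin> {- B..B}" "T N \<notin> {- B..B}"
        using C[of "S N"] C[of "T N"] by (auto simp: truncation_def)
      then show ?case by auto
    qed
  qed
  have main: "(\<lambda>N. LINT s:{S N..T N}|lborel. line_integrand g f s) \<longlonglongrightarrow> line_integral g f"
    unfolding set_lebesgue_integral_def line_integral_def
  proof (rule integral_dominated_convergence[where w = "\<lambda>s. norm (line_integrand g f s)"])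
    show "AE s in lborel. (\<lambda>N. indicator {S N..T N} s *\<^sub>R line_integrand g f s) \<longlonglongrightarrow> line_integrand g f s"
    proof (rule AE_I2)
      fix s :: real
      have "\<forall>\<^sub>F N in sequentially. indicator {S N..T N} s *\<^sub>R line_integrand g f s = line_integrand g f s"
        using exhaust[of "\<bar>s\<bar>"] by eventually_elim (auto simp: indicator_def)
      then show "(\<lambda>N. indicator {S N..T N} s *\<^sub>R line_integrand g f s) \<longlonglongrightarrow> line_integrand g f s"
        by (rule tendsto_eventually)
    qed
  qed (use int in \<open>auto simp: indicator_def\<close>)
  \<comment> \<open>Bounds the height of both end points once each is within 1 of its limit
    \<open>c\<close> or \<open>d\<close>.\<close>
  define K where "K = \<bar>c\<bar> + \<bar>d\<bar> + 1"
  obtain B where B: "B \<longlonglongrightarrow> 0"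
    "\<forall>\<^sub>F N in sequentially. \<forall>z. Re z = real N + 1 / 2 \<and> \<bar>Im z\<bar> \<le> K \<longrightarrow> norm (f z) \<le> B N"
    using decay by blast
  obtain R\<^sub>0 where R\<^sub>0: "\<And>s. R\<^sub>0 \<le> Re (g s) \<Longrightarrow> s < 0 \<Longrightarrow> \<bar>Im (g s) - c\<bar> < 1"
    "\<And>s. R\<^sub>0 \<le> Re (g s) \<Longrightarrow> 0 \<le> s \<Longrightarrow> \<bar>Im (g s) - d\<bar> < 1"
    using tails[of 1] by auto
  have good: "\<forall>\<^sub>F N in sequentially.
      (LINT s:{S N..T N}|lborel. line_integrand g f s) + contour_integral (linepath (g (T N)) (g (S N))) f =
      - (2 * pi * \<i> * (\<Sum>k\<le>N. residue f (of_nat k))) \<and>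
      f contour_integrable_on linepath (g (T N)) (g (S N))"
    using trunc ev[OF winding_number_nat[OF nats]] ev[OF winding_number_left[OF Q fin]]
  proof eventually_elim
    case (elim N)
    have half: "real k \<noteq> real N + 1 / 2" "real k < real N + 1 / 2 \<longleftrightarrow> k \<le> N" for k
    proof -
      \<comment> \<open>A parity argument keeps the naturals off the closing line.\<close>
      have "2 * k \<noteq> 2 * N + 1" by presburger
      then show "real k \<noteq> real N + 1 / 2" by linarith
      show "real k < real N + 1 / 2 \<longleftrightarrow> k \<le> N" by linarith
    qed
    show ?case
      using contour_integral_closed_arc[OF elim(1) holo fin _ _ _ _ int] elim half by auto
  qed
  have seg: "(\<lambda>N. contour_integral (linepath (g (T N)) (g (S N))) f) \<longlonglongrightarrow> 0"
  proof (rule Lim_null_comparison)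
    show "(\<lambda>N. B N * (2 * K)) \<longlonglongrightarrow> 0" using tendsto_mult_left_zero[OF B(1)] .
    show "\<forall>\<^sub>F N in sequentially. norm (contour_integral (linepath (g (T N)) (g (S N))) f) \<le> B N * (2 * K)"
      using good trunc B(2) ev[OF eventually_gt_at_top[of R\<^sub>0]]
    proof eventually_elim
      case (elim N)
      have Re: "Re (g (S N)) = real N + 1 / 2" "Re (g (T N)) = real N + 1 / 2" "S N < 0" "0 < T N"
        using elim by (auto simp: truncation_def)
      have Im: "\<bar>Im (g (S N))\<bar> \<le> K" "\<bar>Im (g (T N))\<bar> \<le> K"
        using R\<^sub>0(1)[of "S N"] R\<^sub>0(2)[of "T N"] Re elim(4) by (auto simp: K_def)
      have le: "norm (f z) \<le> B N" if "z \<in> closed_segment (g (T N)) (g (S N))" for z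
      proof -
        have "closed_segment (g (T N)) (g (S N)) \<subseteq> {z. Im z \<le> K} \<inter> {z. Im z \<ge> - K}"
          by (intro closed_segment_subset convex_Int convex_halfspace_Im_le convex_halfspace_Im_ge)
            (use Im in auto)
        then have "Im z \<le> K" "- K \<le> Im z" using that by blast+
        then have "\<bar>Im z\<bar> \<le> K" by linarith
        moreover have "Re z = real N + 1 / 2"
          using closed_segment_Re_eq[OF that] Re by auto
        ultimately show ?thesis using elim(3) by blast
      qed
      have nonneg: "0 \<le> B N" by (rule order_trans[OF norm_ge_zero le[of "g (T N)"]]) simp
      have "norm (contour_integral (linepath (g (T N)) (g (S N))) f) \<le> B N * norm (g (S N) - g (T N))"
        using contour_integral_bound_linepath[OF _ nonneg le] elim(1) by auto
      also have "norm (g (S N) - g (T N)) \<le> 2 * K"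
        using cmod_le[of "g (S N) - g (T N)"] Re Im by auto
      finally show ?case using nonneg by (simp add: mult_left_mono)
    qed
  qed
  have "(\<lambda>N. - ((LINT s:{S N..T N}|lborel. line_integrand g f s) +
      contour_integral (linepath (g (T N)) (g (S N))) f) / (2 * pi * \<i>)) \<longlonglongrightarrow>
      - (line_integral g f + 0) / (2 * pi * \<i>)"
    by (intro tendsto_intros main seg) auto
  then have "(\<lambda>N. \<Sum>k\<le>N. residue f (of_nat k)) \<longlonglongrightarrow>
      - (line_integral g f + 0) / (2 * pi * \<i>)"
  proof (rule Lim_transform_eventually)
    show "\<forall>\<^sub>F N in sequentially. - ((LINT s:{S N..T N}|lborel. line_integrand g f s) +
      contour_integral (linepath (g (T N)) (g (S N))) f) / (2 * pi * \<i>) =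
      (\<Sum>k\<le>N. residue f (of_nat k))"
      using good by eventually_elim simp
  qed
  then show ?thesis by (simp add: sums_def_le)
qed

end

section \<open>The Mellin-Barnes integral\<close>

context right_loop_around_nats
begin

text \<open>A bound on one compact vertical segment propagates to the right: each unit shift gains a
  factor \<rho>, so the segment at abscissa N + 1/2 carries the bound M \<rho>^(N-n).\<close>

lemma vertical_decay_of_ratio:
  fixes F :: "complex \<Rightarrow> complex"
  assumes cont: "continuous_on {\<eta>. Re \<eta> = real n + 1 / 2} F"
    and ratio: "\<And>\<eta>. Re \<eta> \<ge> real n + 1 / 2 \<Longrightarrow> norm (F (\<eta> + 1)) \<le> \<rho> * norm (F \<eta>)"
    and \<rho>: "0 < \<rho>" "\<rho> < 1"
  shows "\<exists>B. B \<longlonglongrightarrow> 0 \<and> (\<forall>\<^sub>F N in sequentially.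
    \<forall>z. Re z = real N + 1 / 2 \<and> \<bar>Im z\<bar> \<le> K \<longrightarrow> norm (F z) \<le> B N)"
proof -
  define A where "A = {z. Re z = real n + 1 / 2 \<and> \<bar>Im z\<bar> \<le> K}"
  have "A = cbox (Complex (real n + 1 / 2) (- K)) (Complex (real n + 1 / 2) K)"
    by (auto simp: A_def in_cbox_complex_iff)
  then have "compact A" by simp
  moreover have "continuous_on A F" by (rule continuous_on_subset[OF cont]) (auto simp: A_def)
  ultimately have "bounded (F ` A)" by (simp add: compact_continuous_image compact_imp_bounded)
  then obtain M where M: "\<And>z. z \<in> A \<Longrightarrow> norm (F z) \<le> M"
    unfolding bounded_iff by (metis image_eqI)
  have step: "norm (F (z + of_nat j)) \<le> M * \<rho> ^ j" if "z \<in> A" for z j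
  proof (induction j)
    case (Suc j)
    have "norm (F (z + of_nat j + 1)) \<le> \<rho> * norm (F (z + of_nat j))"
      by (rule ratio) (use that in \<open>auto simp: A_def\<close>)
    also have "\<dots> \<le> \<rho> * (M * \<rho> ^ j)" using Suc \<rho> by (intro mult_left_mono) auto
    finally show ?case by (simp add: algebra_simps)
  qed (use M that in simp)
  show ?thesis
  proof (intro exI[of _ "\<lambda>N. M * \<rho> ^ (N - n)"] conjI)
    have "(\<lambda>N. M * \<rho> ^ N) \<longlonglongrightarrow> 0"
      using \<rho> by (intro tendsto_mult_right_zero LIMSEQ_power_zero) auto
    then have "(\<lambda>N. M * \<rho> ^ (N + n - n)) \<longlonglongrightarrow> 0" by simp
    then show "(\<lambda>N. M * \<rho> ^ (N - n)) \<longlonglongrightarrow> 0" by (rule LIMSEQ_offset)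
    show "\<forall>\<^sub>F N in sequentially. \<forall>z. Re z = real N + 1 / 2 \<and> \<bar>Im z\<bar> \<le> K \<longrightarrow>
        norm (F z) \<le> M * \<rho> ^ (N - n)"
      using eventually_ge_at_top[of n]
    proof eventually_elim
      case (elim N)
      show ?case
      proof (intro allI impI)
        fix z assume "Re z = real N + 1 / 2 \<and> \<bar>Im z\<bar> \<le> K"
        then have "z - of_nat (N - n) \<in> A" using elim by (simp add: A_def of_nat_diff)
        from step[OF this, of "N - n"] show "norm (F z) \<le> M * \<rho> ^ (N - n)" by simp
      qed
    qed
  qed
qed

end

text \<open>The Mellin-Barnes integrand of Gauss's hypergeometric function with parameters a, b; e
  at z, up to a constant Gamma factor. For positive z the base -z is negative, and its principal
  power is still entire in \<eta> and equals (-z)^k at a natural k.\<close>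

definition barnes_integrand :: "complex \<Rightarrow> complex \<Rightarrow> complex \<Rightarrow> real \<Rightarrow> complex \<Rightarrow> complex" where
  "barnes_integrand a b e z \<eta> =
     Gamma (a + \<eta>) * Gamma (b + \<eta>) * Gamma (- \<eta>) / Gamma (e + \<eta>) * of_real (- z) powr \<eta>"

text \<open>At a negative integer both sides are 0 by the default value of \<open>Gamma\<close> at
  its poles, so only z = 0 has to be excluded.\<close>

lemma Gamma_plus1_nonzero:
  fixes z :: complex
  assumes "z \<noteq> 0"
  shows "Gamma (z + 1) = z * Gamma z"
  using rGamma_plus1[of z, symmetric] assms by (simp add: Gamma_def field_simps)

text \<open>The shift moves the argument of \<Gamma>(-\<eta>) down by 1, which divides by -(\<eta> +
  1); its sign cancels that of the new factor -z. What results is the term ratio of the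
  hypergeometric series at index \<eta>.\<close>

lemma barnes_integrand_plus1:
  assumes "z \<noteq> 0" "a + \<eta> \<noteq> 0" "b + \<eta> \<noteq> 0" "e + \<eta> \<noteq> 0" "\<eta> + 1 \<noteq> 0"
  shows "barnes_integrand a b e z (\<eta> + 1) =
    z * ((a + \<eta>) / (e + \<eta>)) * ((b + \<eta>) / (\<eta> + 1)) * barnes_integrand a b e z \<eta>"
proof -
  have G: "Gamma (x + (\<eta> + 1)) = (x + \<eta>) * Gamma (x + \<eta>)" if "x + \<eta> \<noteq> 0" for x :: complex
    using Gamma_plus1_nonzero[OF that] by (simp only: add.assoc)
  have "Gamma (- \<eta>) = Gamma (- (\<eta> + 1) + 1)" by simp
  also have "\<dots> = - (\<eta> + 1) * Gamma (- (\<eta> + 1))"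
    by (rule Gamma_plus1_nonzero) (metis assms(5) neg_equal_0_iff_equal)
  finally have 1: "Gamma (- \<eta>) = - (\<eta> + 1) * Gamma (- (\<eta> + 1))" .
  have 2: "complex_of_real (- z) powr (\<eta> + 1) = of_real (- z) powr \<eta> * of_real (- z)"
    using assms(1) by (simp add: powr_add)
  have 3: "x * A * (y * B) * C / (w * D) * (P * of_real (- z)) =
      of_real z * (x / w) * (y / h) * (A * B * (- h * C) / D * P)"
    if "h \<noteq> 0" for x y w h A B C D P :: complex
    using that by (cases "D = 0"; cases "w = 0") (auto simp: field_simps)
  show ?thesis
    unfolding barnes_integrand_def G[OF assms(2)] G[OF assms(3)] G[OF assms(4)] 1 2
    by (rule 3[OF assms(5)])
qed

text \<open>Each quotient in the shift formula is 1 plus a constant over a denominator whose modulus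
  grows with Re \<eta>, so the whole ratio tends to z uniformly in Im \<eta>. The constant (1 + z) /
  2 is the midpoint between z and 1.\<close>

lemma barnes_integrand_ratio:
  assumes z: "0 < z" "z < 1"
  shows "\<forall>\<^sub>F r in at_top. \<forall>\<eta>. r \<le> Re \<eta> \<longrightarrow>
    norm (barnes_integrand a b e z (\<eta> + 1)) \<le> (1 + z) / 2 * norm (barnes_integrand a b e z \<eta>)"
proof -
  have "filterlim (\<lambda>r. r + y) at_top at_top" for y :: real
    unfolding filterlim_at_top
  proof
    fix Z
    show "\<forall>\<^sub>F r in at_top. Z \<le> r + y"
      using eventually_ge_at_top[of "Z - y"] by eventually_elim simp
  qed
  then have "((\<lambda>r. inverse (r + y)) \<longlongrightarrow> 0) at_top" for y :: real
    by (rule tendsto_inverse_0_at_top)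
  from this[of "- norm e"] this[of 1]
  have "((\<lambda>r. z * (1 + norm (a - e) / (r - norm e)) * (1 + norm (b - 1) / (r + 1))) \<longlongrightarrow>
      z * (1 + norm (a - e) * 0) * (1 + norm (b - 1) * 0)) at_top"
    unfolding divide_inverse by (intro tendsto_intros) simp_all
  then have "\<forall>\<^sub>F r in at_top. z * (1 + norm (a - e) / (r - norm e)) * (1 + norm (b - 1) / (r + 1)) < (1 + z) / 2"
    by (rule order_tendstoD) (use z in auto)
  then show ?thesis
    using eventually_gt_at_top[of "norm a + norm b + norm e"]
  proof eventually_elim
    case (elim r)
    show ?case
    proof (intro allI impI)
      fix \<eta> assume \<eta>: "r \<le> Re \<eta>"
      have low: "r - norm x \<le> norm (x + \<eta>)" for x
      proof -
        have "r - norm x \<le> Re \<eta> + Re x" using \<eta> abs_Re_le_cmod[of x] by linarith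
        also have "\<dots> \<le> norm (x + \<eta>)" using complex_Re_le_cmod[of "x + \<eta>"] by simp
        finally show ?thesis .
      qed
      have pos: "r - norm a > 0" "r - norm b > 0" "r - norm e > 0"
        using elim(2) norm_ge_zero[of a] norm_ge_zero[of b] norm_ge_zero[of e] by linarith+
      have nz: "a + \<eta> \<noteq> 0" "b + \<eta> \<noteq> 0" "e + \<eta> \<noteq> 0"
        using pos low[of a] low[of b] low[of e] by fastforce+
      have r: "r > 0" using elim(2) norm_ge_zero[of a] norm_ge_zero[of b] norm_ge_zero[of e] by linarith
      then have nz1: "\<eta> + 1 \<noteq> 0" using \<eta> by (auto simp: complex_eq_iff)
      have low1: "r + 1 \<le> norm (\<eta> + 1)" using complex_Re_le_cmod[of "\<eta> + 1"] \<eta> by simp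
      have 1: "norm ((a + \<eta>) / (e + \<eta>)) \<le> 1 + norm (a - e) / (r - norm e)"
      proof -
        have "(a + \<eta>) / (e + \<eta>) = 1 + (a - e) / (e + \<eta>)" using nz by (simp add: field_simps)
        then have "norm ((a + \<eta>) / (e + \<eta>)) \<le> 1 + norm (a - e) / norm (e + \<eta>)"
          using norm_triangle_ineq[of 1 "(a - e) / (e + \<eta>)"] by (simp add: norm_divide)
        also have "\<dots> \<le> 1 + norm (a - e) / (r - norm e)"
          using low[of e] pos(3) by (intro add_left_mono divide_left_mono) (auto intro!: mult_pos_pos)
        finally show ?thesis .
      qed
      have 2: "norm ((b + \<eta>) / (\<eta> + 1)) \<le> 1 + norm (b - 1) / (r + 1)"
      proof -
        have "(b + \<eta>) / (\<eta> + 1) = 1 + (b - 1) / (\<eta> + 1)" using nz1 by (simp add: field_simps)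
        then have "norm ((b + \<eta>) / (\<eta> + 1)) \<le> 1 + norm (b - 1) / norm (\<eta> + 1)"
          using norm_triangle_ineq[of 1 "(b - 1) / (\<eta> + 1)"] by (simp add: norm_divide)
        also have "\<dots> \<le> 1 + norm (b - 1) / (r + 1)"
          using low1 r by (intro add_left_mono divide_left_mono) (auto intro!: mult_pos_pos)
        finally show ?thesis .
      qed
      have "norm (barnes_integrand a b e z (\<eta> + 1)) =
          z * norm ((a + \<eta>) / (e + \<eta>)) * norm ((b + \<eta>) / (\<eta> + 1)) * norm (barnes_integrand a b e z \<eta>)"
        by (simp only: barnes_integrand_plus1[OF z(1)[THEN less_imp_neq, symmetric] nz nz1]
            norm_mult norm_of_real abs_of_pos[OF z(1)])
      also have "\<dots> \<le> z * (1 + norm (a - e) / (r - norm e)) * (1 + norm (b - 1) / (r + 1)) *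
          norm (barnes_integrand a b e z \<eta>)"
        using z 1 2 pos(3) by (intro mult_right_mono mult_mono) (auto intro!: add_nonneg_nonneg divide_nonneg_pos)
      also have "\<dots> \<le> (1 + z) / 2 * norm (barnes_integrand a b e z \<eta>)"
        using elim(1) by (intro mult_right_mono) auto
      finally show "norm (barnes_integrand a b e z (\<eta> + 1)) \<le> (1 + z) / 2 * norm (barnes_integrand a b e z \<eta>)" .
    qed
  qed
qed

section \<open>Poles and residues of the Barnes integrand\<close>

lemma finite_shifted_nonpos_Ints: "finite {\<eta>. a + \<eta> \<in> \<int>\<^sub>\<le>\<^sub>0 \<and> M \<le> Re \<eta>}" for a :: complex
proof (rule finite_subset)
  show "{\<eta>. a + \<eta> \<in> \<int>\<^sub>\<le>\<^sub>0 \<and> M \<le> Re \<eta>} \<subseteq> (\<lambda>j. - of_nat j - a) ` {..nat \<lceil>- Re a - M\<rceil>}"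
  proof
    fix \<eta> assume \<eta>: "\<eta> \<in> {\<eta>. a + \<eta> \<in> \<int>\<^sub>\<le>\<^sub>0 \<and> M \<le> Re \<eta>}"
    then obtain j where j: "a + \<eta> = - of_nat j" by (auto elim!: nonpos_Ints_cases')
    then have "\<eta> = - of_nat j - a" by (simp add: algebra_simps eq_diff_eq)
    moreover from this have "real j \<le> - Re a - M" using \<eta> by auto
    then have "j \<le> nat \<lceil>- Re a - M\<rceil>" by linarith
    ultimately show "\<eta> \<in> (\<lambda>j. - of_nat j - a) ` {..nat \<lceil>- Re a - M\<rceil>}" by auto
  qed
qed simp

text \<open>Division by \<open>Gamma (e + \<eta>)\<close> is multiplication by the entire function
  \<open>rGamma\<close>, also at the poles, where \<open>Gamma\<close> is 0 by default. So the
  denominator contributes no singularity.\<close>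

lemma barnes_integrand_holomorphic:
  assumes "z \<noteq> 0" "A \<inter> range of_nat = {}" "\<And>\<eta>. \<eta> \<in> A \<Longrightarrow> a + \<eta> \<notin> \<int>\<^sub>\<le>\<^sub>0" "\<And>\<eta>. \<eta> \<in> A \<Longrightarrow> b + \<eta> \<notin> \<int>\<^sub>\<le>\<^sub>0"
  shows "barnes_integrand a b e z holomorphic_on A"
proof -
  have "barnes_integrand a b e z = (\<lambda>\<eta>. Gamma (a + \<eta>) * Gamma (b + \<eta>) * Gamma (- \<eta>) *
      rGamma (e + \<eta>) * exp (\<eta> * Ln (of_real (- z))))"
    using assms(1) by (auto simp: barnes_integrand_def powr_def rGamma_inverse_Gamma divide_inverse)
  moreover have "- \<eta> \<notin> \<int>\<^sub>\<le>\<^sub>0" if "\<eta> \<in> A" for \<eta>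
    using assms(2) that by (auto elim!: nonpos_Ints_cases' simp: neg_eq_iff_add_eq_0 add_eq_0_iff)
  ultimately show ?thesis
    using assms(3,4) by (auto intro!: holomorphic_intros)
qed

text \<open>Only \<Gamma>(-\<eta>) is singular at k. The reflection \<eta> to -\<eta> turns the
  residue (-1)^k / k! of Gamma at -k into its negative, and the remaining factor \<open>G\<close> is
  continuous there.\<close>

lemma residue_barnes_integrand:
  assumes z: "z \<noteq> 0" and ab: "a + of_nat k \<notin> \<int>\<^sub>\<le>\<^sub>0" "b + of_nat k \<notin> \<int>\<^sub>\<le>\<^sub>0"
  shows "residue (barnes_integrand a b e z) (of_nat k) =
    - (Gamma (a + of_nat k) * Gamma (b + of_nat k) / Gamma (e + of_nat k) * of_real z ^ k / fact k)"
proof -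
  \<comment> \<open>Points of the unit ball around k have real part at least -1. Cutting the pole
    sets off there makes \<open>P\<close> finite, hence \<open>U\<close> open, without losing a pole
    inside the ball.\<close>
  define P where "P = {\<eta>. a + \<eta> \<in> \<int>\<^sub>\<le>\<^sub>0 \<and> - 1 \<le> Re \<eta>} \<union> {\<eta>. b + \<eta> \<in> \<int>\<^sub>\<le>\<^sub>0 \<and> - 1 \<le> Re \<eta>}"
  define U where "U = ball (of_nat k) 1 - P"
  define G where "G \<eta> = Gamma (a + \<eta>) * Gamma (b + \<eta>) * rGamma (e + \<eta>) * of_real (- z) powr \<eta>" for \<eta>
  have "finite P" by (simp add: P_def finite_shifted_nonpos_Ints)
  then have "open U" unfolding U_def by (intro open_Diff finite_imp_closed) auto
  have k: "of_nat k \<in> U" using ab by (simp add: U_def P_def)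
  have U: "a + \<eta> \<notin> \<int>\<^sub>\<le>\<^sub>0" "b + \<eta> \<notin> \<int>\<^sub>\<le>\<^sub>0" if "\<eta> \<in> U" for \<eta>
  proof -
    have "\<bar>Re (of_nat k - \<eta>)\<bar> < 1"
      using that abs_Re_le_cmod[of "of_nat k - \<eta>"] by (simp add: U_def dist_norm)
    then have "- 1 \<le> Re \<eta>" by simp
    then show "a + \<eta> \<notin> \<int>\<^sub>\<le>\<^sub>0" "b + \<eta> \<notin> \<int>\<^sub>\<le>\<^sub>0" using that by (auto simp: U_def P_def)
  qed
  have "(U - {of_nat k}) \<inter> range of_nat = {}"
  proof -
    have False if "of_nat j \<in> U" "j \<noteq> k" for j
    proof -
      have "norm (of_int (int k - int j) :: complex) < 1"
        using that by (simp add: U_def dist_norm)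
      then show False using that by (simp only: norm_of_int)
    qed
    then show ?thesis by auto
  qed
  then have holo: "barnes_integrand a b e z holomorphic_on U - {of_nat k}"
    by (intro barnes_integrand_holomorphic z U) auto
  have "((\<lambda>w. Gamma (- w) * (- w + of_nat k)) \<longlongrightarrow> (- 1) ^ k / fact k) (at (of_nat k :: complex))"
  proof (rule filterlim_compose[OF Gamma_residues])
    show "filterlim uminus (at (- of_nat k)) (at (of_nat k :: complex))"
      by (auto simp: filterlim_at eventually_at_filter intro!: tendsto_intros)
  qed
  moreover have "(G \<longlongrightarrow> G (of_nat k)) (at (of_nat k))"
  proof -
    have "G holomorphic_on U"
      unfolding G_def using z U by (auto intro!: holomorphic_intros simp: powr_def)
    then have "isCont G (of_nat k)"
      using holomorphic_on_imp_continuous_on \<open>open U\<close> k continuous_on_eq_continuous_at by blast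
    then show ?thesis by (simp add: isCont_def)
  qed
  ultimately have "((\<lambda>w. - (Gamma (- w) * (- w + of_nat k)) * G w) \<longlongrightarrow>
      - ((- 1) ^ k / fact k) * G (of_nat k)) (at (of_nat k))"
    by (intro tendsto_intros)
  moreover have "- (Gamma (- w) * (- w + of_nat k)) * G w = barnes_integrand a b e z w * (w - of_nat k)" for w
    by (simp add: G_def barnes_integrand_def rGamma_inverse_Gamma field_simps)
  ultimately have "residue (barnes_integrand a b e z) (of_nat k) = - ((- 1) ^ k / fact k) * G (of_nat k)"
    by (intro residue_simple'[OF \<open>open U\<close> k holo]) simp
  also have "\<dots> = - (Gamma (a + of_nat k) * Gamma (b + of_nat k) / Gamma (e + of_nat k) *
      ((- 1) ^ k * of_real (- z) ^ k) / fact k)"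
    using z by (simp add: G_def rGamma_inverse_Gamma field_simps)
  also have "(- 1) ^ k * of_real (- z) ^ k = (of_real z ^ k :: complex)"
    by (simp flip: power_mult_distrib)
  finally show ?thesis .
qed

context right_loop_around_nats
begin

text \<open>The set \<open>Q\<close> of poles of the two increasing Gamma factors has finitely many
  points right of any vertical line, and the ratio estimate yields the decay. The minus sign in each
  residue cancels the one from the orientation of the loop.\<close>

theorem barnes_integral_sums:
  assumes z: "0 < z" "z < 1"
    and nats: "range of_nat \<subseteq> side_of g (\<lambda>r. Complex r ((c + d) / 2))"
    and left: "{\<eta>. a + \<eta> \<in> \<int>\<^sub>\<le>\<^sub>0 \<or> b + \<eta> \<in> \<int>\<^sub>\<le>\<^sub>0} \<subseteq> side_of g (\<lambda>r. Complex (- r) 0)"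
    and ab: "\<And>k. a + of_nat k \<notin> \<int>\<^sub>\<le>\<^sub>0" "\<And>k. b + of_nat k \<notin> \<int>\<^sub>\<le>\<^sub>0"
    and int: "integrable lborel (line_integrand g (barnes_integrand a b e z))"
  shows "(\<lambda>k. Gamma (a + of_nat k) * Gamma (b + of_nat k) / Gamma (e + of_nat k) * of_real z ^ k / fact k)
    sums (line_integral g (barnes_integrand a b e z) / (2 * pi * \<i>))"
proof -
  define Q where "Q = {\<eta>. a + \<eta> \<in> \<int>\<^sub>\<le>\<^sub>0 \<or> b + \<eta> \<in> \<int>\<^sub>\<le>\<^sub>0}"
  have holo: "barnes_integrand a b e z holomorphic_on - (range of_nat \<union> Q)"
    by (rule barnes_integrand_holomorphic) (use z in \<open>auto simp: Q_def\<close>)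
  have "(\<lambda>k. residue (barnes_integrand a b e z) (of_nat k)) sums
      (- line_integral g (barnes_integrand a b e z) / (2 * pi * \<i>))"
  proof (rule residue_sums[OF nats _ _ holo int])
    show "Q \<subseteq> side_of g (\<lambda>r. Complex (- r) 0)" using left by (simp add: Q_def)
    have "{q \<in> Q. M \<le> Re q} = {\<eta>. a + \<eta> \<in> \<int>\<^sub>\<le>\<^sub>0 \<and> M \<le> Re \<eta>} \<union> {\<eta>. b + \<eta> \<in> \<int>\<^sub>\<le>\<^sub>0 \<and> M \<le> Re \<eta>}" for M
      by (auto simp: Q_def)
    then show "finite {q \<in> Q. M \<le> Re q}" for M by (simp add: finite_shifted_nonpos_Ints)
    show "\<exists>B. B \<longlonglongrightarrow> 0 \<and> (\<forall>\<^sub>F N in sequentially. \<forall>\<eta>. Re \<eta> = real N + 1 / 2 \<and> \<bar>Im \<eta>\<bar> \<le> K \<longrightarrow>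
        norm (barnes_integrand a b e z \<eta>) \<le> B N)" for K
    proof -
      obtain R where R: "\<And>\<eta>. R \<le> Re \<eta> \<Longrightarrow>
        norm (barnes_integrand a b e z (\<eta> + 1)) \<le> (1 + z) / 2 * norm (barnes_integrand a b e z \<eta>)"
        using barnes_integrand_ratio[OF z, of a b e] by (auto simp: eventually_at_top_linorder)
      \<comment> \<open>From the abscissa n + 1/2 on, the ratio estimate holds and a + \<eta>, b +
        \<eta> have positive real part, so no pole of \<open>Q\<close> lies on that line.\<close>
      define n where "n = nat \<lceil>max R (max (- Re a) (- Re b))\<rceil>"
      have n: "real n \<ge> R" "real n \<ge> - Re a" "real n \<ge> - Re b" unfolding n_def by linarith+
      show ?thesis
      proof (rule vertical_decay_of_ratio[where n = n and \<rho> = "(1 + z) / 2"])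
        show "norm (barnes_integrand a b e z (\<eta> + 1)) \<le> (1 + z) / 2 * norm (barnes_integrand a b e z \<eta>)"
          if "real n + 1 / 2 \<le> Re \<eta>" for \<eta>
          by (rule R) (use that n in linarith)
        show "continuous_on {\<eta>. Re \<eta> = real n + 1 / 2} (barnes_integrand a b e z)"
        proof (rule continuous_on_subset[OF holomorphic_on_imp_continuous_on[OF holo]], rule subsetI)
          fix \<eta> assume \<eta>: "\<eta> \<in> {\<eta>. Re \<eta> = real n + 1 / 2}"
          have "\<eta> \<noteq> of_nat k" for k
          proof
            assume "\<eta> = of_nat k"
            then have "real k = real n + 1 / 2" using \<eta> by simp
            moreover have "2 * k \<noteq> 2 * n + 1" by presburger
            ultimately show False by linarith
          qed
          moreover have "x \<notin> \<int>\<^sub>\<le>\<^sub>0" if "Re x > 0" for x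
            using that by (auto elim!: nonpos_Ints_cases')
          ultimately show "\<eta> \<in> - (range of_nat \<union> Q)" using n \<eta> by (auto simp: Q_def)
        qed
      qed (use z in auto)
    qed
  qed
  from sums_minus[OF this] show ?thesis
    using z by (simp add: residue_barnes_integrand[OF _ ab])
qed

end

section \<open>The inner integrals\<close>

lemma of_real_powr_exp: "r > 0 \<Longrightarrow> complex_of_real r powr s = exp (s * of_real (ln r))"
  by (simp add: powr_def Ln_of_real)

text \<open>A principal power of a product splits here because the second factor is a nonnegative
  real.\<close>

lemma powr_mult_of_real_powr:
  assumes "r > 0"
  shows "(w * complex_of_real (r powr \<alpha>)) powr \<xi> = w powr \<xi> * of_real r powr (of_real \<alpha> * \<xi>)"
proof -
  have "(w * complex_of_real (r powr \<alpha>)) powr \<xi> = w powr \<xi> * of_real (r powr \<alpha>) powr \<xi>"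
    using powr_times_real_left[of "of_real (r powr \<alpha>)" w \<xi>] by (simp add: mult.commute)
  also have "complex_of_real (r powr \<alpha>) powr \<xi> = of_real r powr (of_real \<alpha> * \<xi>)"
    using assms by (simp add: of_real_powr_exp ln_powr mult_ac)
  finally show ?thesis .
qed

lemma not_set_integrable_inverse: "\<not> set_integrable lborel {0<..<1/2} (\<lambda>t::real. inverse t)"
proof
  assume int: "set_integrable lborel {0<..<1/2} (\<lambda>t::real. inverse t)"
  define I where "I = integral {0<..<1/2} (\<lambda>t::real. inverse t)"
  \<comment> \<open>Chosen so that the integral from \<epsilon> to 1/4, which is ln (1/4) - ln
    \<epsilon> = |I| + 1, exceeds the supposed total \<open>I\<close>.\<close>
  define \<epsilon> where "\<epsilon> = exp (- \<bar>I\<bar> - 1) / 4"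
  have "0 < \<epsilon>" by (simp add: \<epsilon>_def)
  moreover have "\<epsilon> \<le> 1 / 4"
    unfolding \<epsilon>_def by (intro divide_right_mono) (simp_all only: exp_le_one_iff)
  ultimately have \<epsilon>: "0 < \<epsilon>" "\<epsilon> \<le> 1 / 4" by blast+
  have *: "((inverse :: real \<Rightarrow> real) has_integral (ln (1 / 4) - ln \<epsilon>)) {\<epsilon>..1 / 4}"
  proof (rule fundamental_theorem_of_calculus[of \<epsilon> "1 / 4" ln inverse, OF \<epsilon>(2)])
    fix t :: real assume "t \<in> {\<epsilon>..1 / 4}"
    then have "t > 0" using \<epsilon> by auto
    then have "(ln has_real_derivative inverse t) (at t within {\<epsilon>..1 / 4})"
      by (rule has_field_derivative_at_within[OF DERIV_ln])
    then show "(ln has_vector_derivative inverse t) (at t within {\<epsilon>..1 / 4})"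
      by (simp only: has_real_derivative_iff_has_vector_derivative)
  qed
  have "integral {\<epsilon>..1 / 4} (inverse :: real \<Rightarrow> real) \<le> I"
    unfolding I_def
  proof (rule integral_subset_le)
    show "{\<epsilon>..1 / 4} \<subseteq> {0<..<1/2}" using \<epsilon>(1) by auto
    show "inverse integrable_on {\<epsilon>..1 / 4}" using * by blast
    show "inverse integrable_on {0<..<1/2::real}"
      by (rule set_borel_integral_eq_integral(1)[OF int])
    show "\<forall>t\<in>{0<..<1/2}. 0 \<le> inverse (t::real)" by simp
  qed
  then have "ln (1 / 4) - ln \<epsilon> \<le> I" by (simp only: integral_unique[OF *])
  moreover have "ln \<epsilon> = - \<bar>I\<bar> - 1 + ln (1 / 4)"
    unfolding \<epsilon>_def by (simp add: ln_div)
  ultimately show False by linarith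
qed

definition euler_integrand :: "complex \<Rightarrow> complex \<Rightarrow> complex \<Rightarrow> real \<Rightarrow> real \<Rightarrow> complex" where
  "euler_integrand a b \<mu> z t =
     of_real t powr (b - 1) * of_real (1 - t) powr (\<mu> - 1) * of_real (1 - z * t) powr (- a)"

text \<open>On [0, 1/2] the modulus \<open>h\<close> of the other two factors is continuous and
  positive, hence has a positive minimum. If \<open>Re b\<close> were at most 0, the integrand would
  dominate a multiple of 1/t near 0.\<close>

lemma euler_integrand_integrable_imp:
  assumes z: "0 < z" "z < 1" and int: "set_integrable lborel {0<..<1} (euler_integrand a b \<mu> z)"
  shows "Re b > 0"
proof (rule ccontr)
  assume b: "\<not> Re b > 0"
  define h where "h t = (1 - t) powr (Re \<mu> - 1) * (1 - z * t) powr (- Re a)" for t :: real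
  have zt: "z * t < 1" if "0 \<le> t" "t \<le> 1 / 2" for t
  proof -
    have "z * t \<le> 1 * t" using z that by (intro mult_right_mono) auto
    then show ?thesis using that by linarith
  qed
  have "continuous_on {0..1/2} h"
    unfolding h_def using zt by (force intro!: continuous_intros)
  then obtain t\<^sub>0 where t\<^sub>0: "t\<^sub>0 \<in> {0..1/2}" "\<And>t. t \<in> {0..1/2} \<Longrightarrow> h t\<^sub>0 \<le> h t"
    using continuous_attains_inf[of "{0..1/2::real}" h] by auto
  have pos: "h t\<^sub>0 > 0"
    using t\<^sub>0(1) zt[of t\<^sub>0] by (auto simp: h_def)
  have "set_integrable lborel {0<..<1/2} (euler_integrand a b \<mu> z)"
    by (rule set_integrable_subset[OF int]) auto
  then have "integrable lborel (\<lambda>t. inverse (h t\<^sub>0) *\<^sub>R (indicator {0<..<1/2} t *\<^sub>R euler_integrand a b \<mu> z t))"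
    unfolding set_integrable_def by (rule integrable_scaleR_right)
  then have "set_integrable lborel {0<..<1/2} (\<lambda>t::real. inverse t)"
    unfolding set_integrable_def
  proof (rule Bochner_Integration.integrable_bound)
    show "AE t in lborel. norm (indicator {0<..<1/2} t *\<^sub>R inverse t) \<le>
        norm (inverse (h t\<^sub>0) *\<^sub>R (indicator {0<..<1/2} t *\<^sub>R euler_integrand a b \<mu> z t))"
    proof (rule AE_I2)
      fix t :: real
      show "norm (indicator {0<..<1/2} t *\<^sub>R inverse t) \<le>
        norm (inverse (h t\<^sub>0) *\<^sub>R (indicator {0<..<1/2} t *\<^sub>R euler_integrand a b \<mu> z t))"
      proof (cases "0 < t \<and> t < 1 / 2")
        case True
        have "norm (euler_integrand a b \<mu> z t) = t powr (Re b - 1) * h t"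
          using True zt[of t] unfolding euler_integrand_def norm_mult h_def
          by (subst (1 2 3) norm_powr_real_powr) auto
        moreover have "inverse t \<le> t powr (Re b - 1)"
        proof -
          have "inverse t = t powr (- 1)" using True by (simp add: powr_minus)
          also have "\<dots> \<le> t powr (Re b - 1)" using True b by (intro powr_mono') auto
          finally show ?thesis .
        qed
        moreover have "1 \<le> inverse (h t\<^sub>0) * h t"
          using t\<^sub>0(2)[of t] pos True by (simp add: field_simps)
        ultimately have "inverse t * 1 \<le> t powr (Re b - 1) * (inverse (h t\<^sub>0) * h t)"
          using True by (intro mult_mono) auto
        with \<open>norm (euler_integrand a b \<mu> z t) = t powr (Re b - 1) * h t\<close> show ?thesis
          using True pos by (simp add: mult_ac)
      qed simp
    qed
  qed measurable
  then show False using not_set_integrable_inverse by simp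
qed

text \<open>With \<tau> for the new variable, x - t, t - u and t - a become (x - u) \<tau>, (x - u)
  (1 - \<tau>) and (x - a) (1 - z \<tau>). Inside the interval all these factors are positive reals,
  so the principal powers split. The exponents of x - u add up to (\<beta> - 1) + \<alpha> \<xi> -
  (1 - \<mu>).\<close>

lemma euler_substitution:
  fixes a u x :: real
  assumes "a < u" "u < x"
  shows "indicator {u<..<x} (x + - (x - u) * t) *\<^sub>R
      (of_real (x - (x + - (x - u) * t)) powr (\<beta> - 1) *
       (w * of_real ((x - (x + - (x - u) * t)) powr \<alpha>)) powr \<xi> *
       of_real (x + - (x - u) * t - a) powr (- \<nu>) / of_real (x + - (x - u) * t - u) powr (1 - \<mu>)) =
    w powr \<xi> * of_real (x - u) powr (\<beta> + of_real \<alpha> * \<xi> + \<mu> - 2) * of_real (x - a) powr (- \<nu>) *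
      (indicator {0<..<1} t *\<^sub>R euler_integrand \<nu> (\<beta> + of_real \<alpha> * \<xi>) \<mu> ((x - u) / (x - a)) t)"
proof (cases "0 < t \<and> t < 1")
  case True
  define h z where "h = x - u" and "z = (x - u) / (x - a)"
  have h: "h > 0" using assms by (simp add: h_def)
  have z: "z * t < 1"
  proof -
    have "z < 1" "z > 0" using assms by (auto simp: z_def field_simps)
    then show ?thesis using mult_strict_mono[of z 1 t 1] True by simp
  qed
  have e: "x - (x + - (x - u) * t) = h * t" "x + - (x - u) * t - u = h * (1 - t)"
    "x + - (x - u) * t - a = (x - a) * (1 - z * t)"
    using assms by (simp_all add: h_def z_def field_simps)
  have "x + - (x - u) * t \<in> {u<..<x}"
  proof -
    have "h * t > 0" "h * (1 - t) > 0" using h True by auto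
    then show ?thesis using e by auto
  qed
  moreover have "of_real (h * t) powr (\<beta> - 1) * (w * of_real ((h * t) powr \<alpha>)) powr \<xi> *
      of_real ((x - a) * (1 - z * t)) powr (- \<nu>) / of_real (h * (1 - t)) powr (1 - \<mu>) =
    w powr \<xi> * of_real h powr (\<beta> + of_real \<alpha> * \<xi> + \<mu> - 2) * of_real (x - a) powr (- \<nu>) *
      euler_integrand \<nu> (\<beta> + of_real \<alpha> * \<xi>) \<mu> z t"
  proof -
    have 1: "of_real (h * t) powr s = of_real h powr s * of_real t powr s"
      "of_real (h * (1 - t)) powr s = of_real h powr s * of_real (1 - t) powr s"
      "of_real ((x - a) * (1 - z * t)) powr s = of_real (x - a) powr s * of_real (1 - z * t) powr s"
      for s :: complex
      unfolding of_real_mult using h True z assms by (subst powr_times_real; simp)+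
    have 2: "of_real h powr (\<beta> - 1) * of_real h powr (of_real \<alpha> * \<xi>) / of_real h powr (1 - \<mu>) =
        of_real h powr (\<beta> + of_real \<alpha> * \<xi> + \<mu> - 2)"
      by (simp flip: powr_add powr_diff) (simp add: algebra_simps)
    have 3: "of_real t powr (\<beta> - 1) * of_real t powr (of_real \<alpha> * \<xi>) =
        of_real t powr (\<beta> + of_real \<alpha> * \<xi> - 1)"
      by (simp flip: powr_add) (simp add: algebra_simps)
    have 4: "1 / of_real (1 - t) powr (1 - \<mu>) = of_real (1 - t) powr (\<mu> - 1)"
      using powr_minus[of "complex_of_real (1 - t)" "1 - \<mu>"] by (simp add: divide_inverse)
    have ht: "h * t > 0" using h True by simp
    show ?thesis
      unfolding powr_mult_of_real_powr[OF ht] 1 euler_integrand_def 2[symmetric] 3[symmetric] 4[symmetric]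
      by (simp add: divide_inverse mult_ac)
  qed
  ultimately show ?thesis using True unfolding e by (simp add: h_def z_def)
next
  case False
  have "x + - (x - u) * t \<notin> {u<..<x}"
  proof
    assume "x + - (x - u) * t \<in> {u<..<x}"
    then have "(x - u) * t > 0" "(x - u) * (1 - t) > 0" by (auto simp: algebra_simps)
    then show False using False assms by (simp add: zero_less_mult_iff)
  qed
  then show ?thesis using False by simp
qed

text \<open>The substitution reverses orientation, but the Lebesgue integral sees only the absolute
  value x - u of its slope, which raises the exponent of x - u by one. The constant in front is
  nonzero when \<open>w\<close> is, so integrability passes to Euler's integrand.\<close>

lemma euler_affine:
  fixes a u x \<alpha> :: real and \<beta> \<mu> \<nu> \<xi> w :: complex
  assumes "a < u" "u < x"
  defines "f \<equiv> \<lambda>t. of_real (x - t) powr (\<beta> - 1) * (w * of_real ((x - t) powr \<alpha>)) powr \<xi> *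
    of_real (t - a) powr (- \<nu>) / of_real (t - u) powr (1 - \<mu>)"
  shows "(LINT t:{u<..<x}|lborel. f t) =
      w powr \<xi> * of_real (x - u) powr (\<beta> + of_real \<alpha> * \<xi> + \<mu> - 1) * of_real (x - a) powr (- \<nu>) *
      (LINT t:{0<..<1}|lborel. euler_integrand \<nu> (\<beta> + of_real \<alpha> * \<xi>) \<mu> ((x - u) / (x - a)) t)"
    and "w \<noteq> 0 \<Longrightarrow> set_integrable lborel {u<..<x} f \<Longrightarrow>
      set_integrable lborel {0<..<1} (euler_integrand \<nu> (\<beta> + of_real \<alpha> * \<xi>) \<mu> ((x - u) / (x - a)))"
proof -
  define C where "C = w powr \<xi> * of_real (x - u) powr (\<beta> + of_real \<alpha> * \<xi> + \<mu> - 2) * of_real (x - a) powr (- \<nu>)"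
  define E where "E = euler_integrand \<nu> (\<beta> + of_real \<alpha> * \<xi>) \<mu> ((x - u) / (x - a))"
  have c: "- (x - u) \<noteq> 0" using assms by simp
  have sub: "indicator {u<..<x} (x + - (x - u) * t) *\<^sub>R f (x + - (x - u) * t) =
      C * (indicator {0<..<1} t *\<^sub>R E t)" for t
    unfolding f_def C_def E_def by (rule euler_substitution[OF assms(1,2)])
  have "(LINT t:{u<..<x}|lborel. f t) = \<bar>- (x - u)\<bar> *\<^sub>R
      (LINT t|lborel. indicator {u<..<x} (x + - (x - u) * t) *\<^sub>R f (x + - (x - u) * t))"
    unfolding set_lebesgue_integral_def by (rule lborel_integral_real_affine[OF c])
  also have "\<bar>- (x - u)\<bar> = x - u" using assms by simp
  also have "(LINT t|lborel. indicator {u<..<x} (x + - (x - u) * t) *\<^sub>R f (x + - (x - u) * t)) =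
      C * (LINT t:{0<..<1}|lborel. E t)"
    unfolding set_lebesgue_integral_def sub by (rule integral_mult_right_zero)
  also have "(x - u) *\<^sub>R (C * (LINT t:{0<..<1}|lborel. E t)) =
      w powr \<xi> * (of_real (x - u) * of_real (x - u) powr (\<beta> + of_real \<alpha> * \<xi> + \<mu> - 2)) * of_real (x - a) powr (- \<nu>) *
      (LINT t:{0<..<1}|lborel. E t)"
    by (simp only: C_def scaleR_conv_of_real mult_ac)
  also have "of_real (x - u) * of_real (x - u) powr (\<beta> + of_real \<alpha> * \<xi> + \<mu> - 2) =
      complex_of_real (x - u) powr (\<beta> + of_real \<alpha> * \<xi> + \<mu> - 1)"
    using assms powr_add[of "complex_of_real (x - u)" 1 "\<beta> + of_real \<alpha> * \<xi> + \<mu> - 2"]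
    by (simp add: algebra_simps)
  finally show "(LINT t:{u<..<x}|lborel. f t) =
      w powr \<xi> * of_real (x - u) powr (\<beta> + of_real \<alpha> * \<xi> + \<mu> - 1) * of_real (x - a) powr (- \<nu>) *
      (LINT t:{0<..<1}|lborel. euler_integrand \<nu> (\<beta> + of_real \<alpha> * \<xi>) \<mu> ((x - u) / (x - a)) t)"
    unfolding E_def .
  assume w: "w \<noteq> 0" and "set_integrable lborel {u<..<x} f"
  then have "integrable lborel (\<lambda>t. C * (indicator {0<..<1} t *\<^sub>R E t))"
    unfolding set_integrable_def sub[symmetric] by (subst lborel_integrable_real_affine_iff[OF c])
  then show "set_integrable lborel {0<..<1} (euler_integrand \<nu> (\<beta> + of_real \<alpha> * \<xi>) \<mu> ((x - u) / (x - a)))"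
  proof -
    have C: "C \<noteq> 0" using w assms(1,2) by (simp add: C_def flip: of_real_diff)
    assume "integrable lborel (\<lambda>t. C * (indicator {0<..<1} t *\<^sub>R E t))"
    then have "integrable lborel (\<lambda>t. inverse C * (C * (indicator {0<..<1} t *\<^sub>R E t)))"
      by (rule integrable_mult_right)
    then show ?thesis
      unfolding set_integrable_def E_def[symmetric]
      by (simp only: mult.assoc[symmetric] left_inverse[OF C] mult_1_left)
  qed
qed

context right_loop_around_nats
begin

text \<open>Both sides sum the same series: \<open>Gamma (a + of_nat k) / Gamma a\<close> is the
  Pochhammer symbol, and the other Gamma quotient, multiplied by \<open>Gamma \<mu>\<close>, is a
  Beta value.\<close>

theorem euler_integral_eq_barnes_integral:
  assumes z: "0 < z" "z < 1" and re: "Re b > 0" "Re \<mu> > 0"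
    and nats: "range of_nat \<subseteq> side_of g (\<lambda>r. Complex r ((c + d) / 2))"
    and left: "{\<eta>. a + \<eta> \<in> \<int>\<^sub>\<le>\<^sub>0 \<or> b + \<eta> \<in> \<int>\<^sub>\<le>\<^sub>0} \<subseteq> side_of g (\<lambda>r. Complex (- r) 0)"
    and a: "\<And>k. a + of_nat k \<notin> \<int>\<^sub>\<le>\<^sub>0"
    and int: "integrable lborel (line_integrand g (barnes_integrand a b (b + \<mu>) z))"
  shows "(LINT t:{0<..<1}|lborel. euler_integrand a b \<mu> z t) =
    Gamma \<mu> / Gamma a * (line_integral g (barnes_integrand a b (b + \<mu>) z) / (2 * pi * \<i>))"
proof -
  have b: "b + of_nat k \<notin> \<int>\<^sub>\<le>\<^sub>0" for k
  proof
    assume "b + of_nat k \<in> \<int>\<^sub>\<le>\<^sub>0"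
    then obtain j where "b + of_nat k = - of_nat j" by (auto elim!: nonpos_Ints_cases')
    then have "Re (b + of_nat k) = - real j" by simp
    then show False using re by simp
  qed
  have a0: "a \<notin> \<int>\<^sub>\<le>\<^sub>0" using a[of 0] by simp
  have "(\<lambda>k. Gamma \<mu> / Gamma a * (Gamma (a + of_nat k) * Gamma (b + of_nat k) /
      Gamma (b + \<mu> + of_nat k) * of_real z ^ k / fact k)) sums
      (Gamma \<mu> / Gamma a * (line_integral g (barnes_integrand a b (b + \<mu>) z) / (2 * pi * \<i>)))"
    by (intro sums_mult barnes_integral_sums z nats left a b int)
  moreover have "Gamma \<mu> / Gamma a * (Gamma (a + of_nat k) * Gamma (b + of_nat k) /
      Gamma (b + \<mu> + of_nat k) * of_real z ^ k / fact k) =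
      pochhammer a k / fact k * of_real z ^ k * Beta (b + of_nat k) \<mu>" for k
    using pochhammer_Gamma[OF a0, of k] by (simp add: Beta_def add_ac mult_ac)
  ultimately have "(\<lambda>k. pochhammer a k / fact k * of_real z ^ k * Beta (b + of_nat k) \<mu>) sums
      (Gamma \<mu> / Gamma a * (line_integral g (barnes_integrand a b (b + \<mu>) z) / (2 * pi * \<i>)))"
    by simp
  moreover have "(\<lambda>k. pochhammer a k / fact k * of_real z ^ k * Beta (b + of_nat k) \<mu>) sums
      (LINT t:{0<..<1}|lborel. euler_integrand a b \<mu> z t)"
    unfolding euler_integrand_def using Euler_integral_sums[OF re, of z a] z by simp
  ultimately show ?thesis by (rule sums_unique2[symmetric])
qed

end

section \<open>Fubini for three variables and the contour hypotheses\<close>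

lemma LINT_LINT_LINT_rotate:
  fixes f :: "real \<Rightarrow> real \<Rightarrow> real \<Rightarrow> complex"
  assumes "integrable lborel (\<lambda>(t, u, s). f t u s)"
  shows "(LINT t|lborel. LINT u|lborel. LINT s|lborel. f t u s) =
      (LINT u|lborel. LINT s|lborel. LINT t|lborel. f t u s)"
    and "AE u in lborel. AE s in lborel. integrable lborel (\<lambda>t. f t u s)"
proof -
  have int: "integrable (lborel \<Otimes>\<^sub>M (lborel \<Otimes>\<^sub>M lborel)) (\<lambda>(t, u, s). f t u s)"
    using assms by (simp add: lborel_prod)
  then have meas: "(\<lambda>(t, u, s). f t u s) \<in> borel_measurable (lborel \<Otimes>\<^sub>M (lborel \<Otimes>\<^sub>M lborel))"
    by (rule borel_measurable_integrable)
  have int': "integrable (lborel \<Otimes>\<^sub>M lborel) (\<lambda>(t, p). f t (fst p) (snd p))"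
    using assms by (simp add: lborel_prod case_prod_unfold)
  have "(LINT t|lborel. LINT u|lborel. LINT s|lborel. f t u s) =
      (LINT t|lborel. LINT p|lborel. f t (fst p) (snd p))"
  \<comment> \<open>Only almost every slice at \<open>t\<close> is known to be integrable, so
    merging the two inner integrals is an identity for almost every \<open>t\<close>.\<close>
  proof (rule integral_cong_AE)
    show "AE t in lborel. (LINT u|lborel. LINT s|lborel. f t u s) = (LINT p|lborel. f t (fst p) (snd p))"
      using lborel_pair.AE_integrable_fst[OF int']
    proof eventually_elim
      case (elim t)
      then have "integrable (lborel \<Otimes>\<^sub>M lborel) (\<lambda>(u, s). f t u s)"
        by (simp add: lborel_prod case_prod_unfold)
      from lborel_pair.integral_fst[OF this] show ?case
        by (simp add: lborel_prod case_prod_unfold)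
    qed
    define F where "F = (\<lambda>(t, u, s). f t u s)"
    have [measurable]: "F \<in> borel_measurable (lborel \<Otimes>\<^sub>M (lborel \<Otimes>\<^sub>M lborel))"
      using meas by (simp add: F_def)
    have "(\<lambda>t. LINT u|lborel. LINT s|lborel. F (t, u, s)) \<in> borel_measurable lborel" by measurable
    then show "(\<lambda>t. LINT u|lborel. LINT s|lborel. f t u s) \<in> borel_measurable lborel"
      by (simp add: F_def)
    show "(\<lambda>t. LINT p|lborel. f t (fst p) (snd p)) \<in> borel_measurable lborel"
      using lborel_pair.integrable_fst[OF int'] by (rule borel_measurable_integrable)
  qed
  also have "\<dots> = (LINT p|lborel. LINT t|lborel. f t (fst p) (snd p))"
    by (rule lborel_pair.Fubini_integral[OF int', symmetric])
  also have "\<dots> = (LINT u|lborel. LINT s|lborel. LINT t|lborel. f t u s)"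
  proof -
    have "integrable (lborel \<Otimes>\<^sub>M lborel) (\<lambda>(u, s). LINT t|lborel. f t u s)"
      using lborel_pair.integrable_snd[OF int'] by (simp add: lborel_prod case_prod_unfold)
    from lborel_pair.integral_fst[OF this] show ?thesis
      by (simp add: lborel_prod case_prod_unfold)
  qed
  finally show "(LINT t|lborel. LINT u|lborel. LINT s|lborel. f t u s) =
      (LINT u|lborel. LINT s|lborel. LINT t|lborel. f t u s)" .
  \<comment> \<open>From this integrability in \<open>t\<close> alone, the positivity of
    \<open>Re (\<beta> + \<alpha> \<xi>)\<close> will be deduced.\<close>
  have "AE p in lborel \<Otimes>\<^sub>M lborel. integrable lborel (\<lambda>t. f t (fst p) (snd p))"
    unfolding lborel_prod by (rule lborel_pair.AE_integrable_snd[OF int'])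
  from lborel_pair.AE_pair[OF this] show "AE u in lborel. AE s in lborel. integrable lborel (\<lambda>t. f t u s)"
    by simp
qed

text \<open>The limits of the curve at both ends determine its kind and its two heights, so only one
  alternative in \<open>separates\<close> survives.\<close>

lemma separates_right_loop:
  assumes "right_loop c d g" "separates g P Q"
  shows "P \<subseteq> side_of g (\<lambda>r. Complex r ((c + d) / 2))" "Q \<subseteq> side_of g (\<lambda>r. Complex (- r) 0)"
proof -
  have top: "filterlim (\<lambda>s. Re (g s)) at_top at_top"
    and lims: "((\<lambda>s. Im (g s)) \<longlongrightarrow> c) at_bot" "((\<lambda>s. Im (g s)) \<longlongrightarrow> d) at_top"
    using assms(1) by (auto simp: right_loop_def)
  have "\<not> vertical_contour g"
  proof
    assume "vertical_contour g"
    then obtain B where B: "\<bar>Re (g s)\<bar> \<le> B" for s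
      by (auto simp: vertical_contour_def bounded_iff)
    have "\<forall>\<^sub>F s in at_top. B < Re (g s)" using top by (simp add: filterlim_at_top_dense)
    then obtain s where "B < Re (g s)" using eventually_happens by force
    then show False using B[of s] by simp
  qed
  moreover have "\<not> left_loop c' d' g" for c' d'
  proof
    assume "left_loop c' d' g"
    then have "filterlim (\<lambda>s. Re (g s)) at_bot at_top" by (simp add: left_loop_def)
    then have "\<forall>\<^sub>F s in at_top. Re (g s) < 0" by (simp add: filterlim_at_bot_dense)
    moreover have "\<forall>\<^sub>F s in at_top. 0 < Re (g s)" using top by (simp add: filterlim_at_top_dense)
    ultimately have "\<forall>\<^sub>F s::real in at_top. False" by eventually_elim simp
    then show False by simp
  qed
  moreover have "c' = c \<and> d' = d" if "right_loop c' d' g" for c' d'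
    using that lims by (auto simp: right_loop_def dest: tendsto_unique[rotated])
  ultimately show "P \<subseteq> side_of g (\<lambda>r. Complex r ((c + d) / 2))" "Q \<subseteq> side_of g (\<lambda>r. Complex (- r) 0)"
    using assms(2) unfolding separates_def by auto
qed

lemma fox2_integrand_eq_barnes:
  "fox2_integrand 1 [(1 - \<beta>, \<alpha>, 1)] [(1 - \<mu> - \<beta>, \<alpha>, 1)] m n ups lows 1 1 [(1 - \<mu> - \<gamma>, 1)] [(0, 1)]
     X (of_real (- z)) \<xi> \<eta> =
   fox_kernel m n ups lows \<xi> * X powr \<xi> *
     barnes_integrand (\<mu> + \<gamma>) (\<beta> + of_real \<alpha> * \<xi>) (\<beta> + of_real \<alpha> * \<xi> + \<mu>) z \<eta>"
proof -
  have "fox_kernel 1 1 [(1 - \<mu> - \<gamma>, 1)] [(0, 1)] \<eta> = Gamma (- \<eta>) * Gamma (\<mu> + \<gamma> + \<eta>)"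
    by (simp add: fox_kernel_def)
  moreover have "fox2_Phi 1 [(1 - \<beta>, \<alpha>, 1)] [(1 - \<mu> - \<beta>, \<alpha>, 1)] \<xi> \<eta> =
      Gamma (\<beta> + of_real \<alpha> * \<xi> + \<eta>) / Gamma (\<beta> + of_real \<alpha> * \<xi> + \<mu> + \<eta>)"
    by (simp add: fox2_Phi_def algebra_simps)
  ultimately show ?thesis
    unfolding fox2_integrand_def barnes_integrand_def by (simp only:) (simp add: field_simps)
qed

text \<open>
  At fixed \<open>u\<close> and \<open>\<xi>\<close> the two sides share the factor \<open>C\<close>, which may vanish. Where it does not,
  integrability in \<open>t\<close> alone forces \<open>Re (\<beta> + \<alpha> \<xi>) > 0\<close>, as Euler's integral requires.
\<close>

lemma inner_integrals_eq:
  fixes a u x \<alpha> :: real and \<beta> \<gamma> \<mu> \<xi> w C :: complex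
  assumes u: "a < u" "u < x" and \<mu>: "Re \<mu> > 0" and w: "w \<noteq> 0"
    and loop: "right_loop c d g" "c < 0" "0 < d"
    and nats: "range of_nat \<subseteq> side_of g (\<lambda>r. Complex r ((c + d) / 2))"
    and left: "{\<eta>. \<mu> + \<gamma> + \<eta> \<in> \<int>\<^sub>\<le>\<^sub>0 \<or> \<beta> + of_real \<alpha> * \<xi> + \<eta> \<in> \<int>\<^sub>\<le>\<^sub>0} \<subseteq> side_of g (\<lambda>r. Complex (- r) 0)"
    and poles: "\<And>k. \<mu> + \<gamma> + of_nat k \<notin> \<int>\<^sub>\<le>\<^sub>0"
  defines "b \<equiv> \<beta> + of_real \<alpha> * \<xi>"
  defines "f \<equiv> \<lambda>t. of_real (x - t) powr (\<beta> - 1) * (w * of_real ((x - t) powr \<alpha>)) powr \<xi> *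
      of_real (t - a) powr (- (\<mu> + \<gamma>)) / of_real (t - u) powr (1 - \<mu>)"
  defines "B \<equiv> barnes_integrand (\<mu> + \<gamma>) b (b + \<mu>) ((x - u) / (x - a))"
  assumes int_t: "C \<noteq> 0 \<Longrightarrow> set_integrable lborel {u<..<x} f"
    and int_r: "C \<noteq> 0 \<Longrightarrow> integrable lborel (line_integrand g B)"
  shows "C * (LINT t:{u<..<x}|lborel. f t) / Gamma \<mu> =
    of_real (x - u) powr (\<mu> + \<beta> - 1) * (of_real (x - a) powr (- (\<mu> + \<gamma>)) / Gamma (\<mu> + \<gamma>)) * C *
    (w * of_real ((x - u) powr \<alpha>)) powr \<xi> * line_integral g B / (2 * pi * \<i>)"
proof (cases "C = 0")
  case False
  interpret right_loop_around_nats g c d by standard (use loop in auto)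
  have z: "0 < (x - u) / (x - a)" "(x - u) / (x - a) < 1" using u by (auto simp: field_simps)
  \<comment> \<open>The end t = x of the original interval corresponds to \<tau> = 0, where the
    exponent b - 1 decides convergence.\<close>
  have "set_integrable lborel {0<..<1} (euler_integrand (\<mu> + \<gamma>) b \<mu> ((x - u) / (x - a)))"
    using euler_affine(2)[OF u w int_t[OF False, unfolded f_def]] unfolding b_def .
  from euler_integrand_integrable_imp[OF z this] have "Re b > 0" .
  from euler_integral_eq_barnes_integral[OF z this \<mu> nats left[folded b_def] poles int_r[OF False, unfolded B_def]]
  have E: "(LINT t:{0<..<1}|lborel. euler_integrand (\<mu> + \<gamma>) b \<mu> ((x - u) / (x - a)) t) =
      Gamma \<mu> / Gamma (\<mu> + \<gamma>) * (line_integral g B / (2 * pi * \<i>))"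
    unfolding B_def .
  have F: "(LINT t:{u<..<x}|lborel. f t) =
      w powr \<xi> * of_real (x - u) powr (b + \<mu> - 1) * of_real (x - a) powr (- (\<mu> + \<gamma>)) *
      (Gamma \<mu> / Gamma (\<mu> + \<gamma>) * (line_integral g B / (2 * pi * \<i>)))"
    unfolding f_def euler_affine(1)[OF u] E[symmetric] b_def ..
  have alg: "C * (P * A * (M / N * (l / T))) / M = H * (A / N) * C * W * l / T"
    if "H * W = P" "M \<noteq> 0" for P A M N l T H W :: complex
    unfolding that(1)[symmetric] using that(2) by (simp add: divide_inverse mult_ac)
  have "Gamma \<mu> \<noteq> 0" using \<mu> by (auto simp: Gamma_eq_zero_iff elim!: nonpos_Ints_cases')
  moreover have "of_real (x - u) powr (\<mu> + \<beta> - 1) * (w * of_real ((x - u) powr \<alpha>)) powr \<xi> =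
      w powr \<xi> * of_real (x - u) powr (b + \<mu> - 1)"
  proof -
    have "complex_of_real (x - u) powr (\<mu> + \<beta> - 1) * of_real (x - u) powr (of_real \<alpha> * \<xi>) =
        of_real (x - u) powr (b + \<mu> - 1)"
      by (simp only: powr_add[symmetric] b_def) (simp add: algebra_simps)
    then show ?thesis
      using powr_mult_of_real_powr[of "x - u" w \<alpha> \<xi>] u by (simp only: diff_gt_0_iff_gt mult_ac)
  qed
  ultimately show ?thesis
    unfolding F by (intro alg)
qed simp

theorem theorem1:
  fixes a x \<alpha> :: real and \<beta> \<gamma> \<mu> w :: complex and m n p q :: nat
    and ups lows :: "(complex \<times> real) list"
    and \<phi> :: "real \<Rightarrow> complex" and L L\<^sub>2 :: "real \<Rightarrow> complex" and c d :: real
  assumes "x > a" and "\<alpha> > 0"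
    and "Re \<gamma> > - 1" and "Re \<mu> > 0" and "Re \<beta> > 0" and "w \<noteq> 0"
    and "length ups = p" and "length lows = q"
    and "\<forall>(a\<^sub>j, \<alpha>\<^sub>j)\<in>set ups. \<alpha>\<^sub>j > 0" and "\<forall>(b\<^sub>j, \<beta>\<^sub>j)\<in>set lows. \<beta>\<^sub>j > 0"
    and "1 \<le> m" and "m \<le> q" and "0 \<le> n" and "n \<le> p"
    and "Re \<beta> + Min ((\<lambda>(b\<^sub>j, \<beta>\<^sub>j). Re (of_real \<alpha> * b\<^sub>j / of_real \<beta>\<^sub>j)) ` set (take m lows)) > 0"
    and "\<forall>u\<in>{a<..<x}. \<bar>(x - u) / (x - a)\<bar> < 1"
    and "set_integrable lborel {a<..<x} \<phi>"
    and H_contour: "\<forall>t\<in>{a<..<x}. fox_H_contour L m n ups lows (w * of_real ((x - t) powr \<alpha>))"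
    and H2_contours: "\<forall>u\<in>{a<..<x}. fox_H2_contours L L\<^sub>2
          1 [(1 - \<beta>, \<alpha>, 1)] [(1 - \<mu> - \<beta>, \<alpha>, 1)]
          m n ups lows
          1 1 [(1 - \<mu> - \<gamma>, 1)] [(0, 1)]
          (w * of_real ((x - u) powr \<alpha>)) (of_real (- ((x - u) / (x - a))))"
    and L2_loop: "right_loop c d L\<^sub>2" "c < 0" "0 < d"
    and lhs_abs_conv: "set_integrable lborel {(t, u, s). a < u \<and> u < t \<and> t < x}
          (\<lambda>(t, u, s). of_real (x - t) powr (\<beta> - 1) *
             line_integrand L (\<lambda>\<xi>. fox_kernel m n ups lows \<xi> * (w * of_real ((x - t) powr \<alpha>)) powr \<xi>) s *
             (of_real (t - a) powr (- \<mu> - \<gamma>) / Gamma \<mu> *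
             (of_real u powr \<gamma> * \<phi> u / of_real (t - u) powr (1 - \<mu>))))"
    and rhs_abs_conv: "set_integrable lborel {(u, s, r). a < u \<and> u < x}
          (\<lambda>(u, s, r). of_real u powr \<gamma> * of_real (x - u) powr (\<mu> + \<beta> - 1) *
             (of_real (x - a) powr (- \<mu> - \<gamma>) / Gamma (\<mu> + \<gamma>)) *
             line_integrand L (\<lambda>\<xi>. line_integrand L\<^sub>2 (fox2_integrand
               1 [(1 - \<beta>, \<alpha>, 1)] [(1 - \<mu> - \<beta>, \<alpha>, 1)]
               m n ups lows
               1 1 [(1 - \<mu> - \<gamma>, 1)] [(0, 1)]
               (w * of_real ((x - u) powr \<alpha>)) (of_real (- ((x - u) / (x - a)))) \<xi>) r) s * \<phi> u)"
  shows "H_op L a w m n \<alpha> ups lows \<beta> (I_op a \<gamma> \<mu> \<phi>) x =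
    (LINT u:{a<..<x}|lborel. of_real u powr \<gamma> * of_real (x - u) powr (\<mu> + \<beta> - 1) *
       (of_real (x - a) powr (- \<mu> - \<gamma>) / Gamma (\<mu> + \<gamma>)) *
       fox_H2 L L\<^sub>2
         1 [(1 - \<beta>, \<alpha>, 1)] [(1 - \<mu> - \<beta>, \<alpha>, 1)]
         m n ups lows
         1 1 [(1 - \<mu> - \<gamma>, 1)] [(0, 1)]
         (w * of_real ((x - u) powr \<alpha>)) (of_real (- ((x - u) / (x - a)))) * \<phi> u)"
proof -
  let ?lhs = "\<lambda>t u s. of_real (x - t) powr (\<beta> - 1) *
     line_integrand L (\<lambda>\<xi>. fox_kernel m n ups lows \<xi> * (w * of_real ((x - t) powr \<alpha>)) powr \<xi>) s *
     (of_real (t - a) powr (- \<mu> - \<gamma>) / Gamma \<mu> *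
     (of_real u powr \<gamma> * \<phi> u / of_real (t - u) powr (1 - \<mu>)))"
  let ?fox2 = "\<lambda>u. fox2_integrand 1 [(1 - \<beta>, \<alpha>, 1)] [(1 - \<mu> - \<beta>, \<alpha>, 1)] m n ups lows
     1 1 [(1 - \<mu> - \<gamma>, 1)] [(0, 1)] (w * of_real ((x - u) powr \<alpha>)) (of_real (- ((x - u) / (x - a))))"
  let ?rhs = "\<lambda>u s r. of_real u powr \<gamma> * of_real (x - u) powr (\<mu> + \<beta> - 1) *
     (of_real (x - a) powr (- \<mu> - \<gamma>) / Gamma (\<mu> + \<gamma>)) *
     line_integrand L (\<lambda>\<xi>. line_integrand L\<^sub>2 (?fox2 u \<xi>) r) s * \<phi> u"
  let ?B = "\<lambda>u s. barnes_integrand (\<mu> + \<gamma>) (\<beta> + of_real \<alpha> * L s) (\<beta> + of_real \<alpha> * L s + \<mu>) ((x - u) / (x - a))"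
  define \<kappa> :: complex where "\<kappa> = 1 / (2 * of_real pi * \<i>)"
  \<comment> \<open>Extension by zero off the region turns all iterated integrals into integrals
    over the full line, so their order can be changed without adjusting limits.\<close>
  define F where "F t u s = indicator {(t, u, s). a < u \<and> u < t \<and> t < x} (t, u, s) *\<^sub>R ?lhs t u s"
    for t u s :: real
  define G where "G u s r = indicator {(u, s, r). a < u \<and> u < x} (u, s, r) *\<^sub>R ?rhs u s r"
    for u s r :: real
  have intF: "integrable lborel (\<lambda>(t, u, s). F t u s)"
    using lhs_abs_conv unfolding set_integrable_def F_def by (simp only: case_prod_unfold prod.collapse)
  have intG: "integrable lborel (\<lambda>(u, s, r). G u s r)"
    using rhs_abs_conv unfolding set_integrable_def G_def by (simp only: case_prod_unfold prod.collapse)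
  have F_0: "F t u s = 0" if "u \<notin> {a<..<x}" for t u s using that by (auto simp: F_def)
  have G_0: "G u s r = 0" if "u \<notin> {a<..<x}" for u s r using that by (auto simp: G_def)

  have lhs: "H_op L a w m n \<alpha> ups lows \<beta> (I_op a \<gamma> \<mu> \<phi>) x =
      \<kappa> * (LINT t|lborel. LINT u|lborel. LINT s|lborel. F t u s)"
  proof -
    have "indicator {a<..<x} t *\<^sub>R (of_real (x - t) powr (\<beta> - 1) *
        fox_H L m n ups lows (w * of_real ((x - t) powr \<alpha>)) * I_op a \<gamma> \<mu> \<phi> t) =
        \<kappa> * (LINT u|lborel. LINT s|lborel. F t u s)" for t
    proof (cases "t \<in> {a<..<x}")
      case True
      define A where "A = complex_of_real (x - t) powr (\<beta> - 1) * (of_real (t - a) powr (- \<mu> - \<gamma>) / Gamma \<mu>)"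
      define q where "q u = of_real u powr \<gamma> * \<phi> u / of_real (t - u) powr (1 - \<mu>)" for u
      define l where "l = line_integrand L (\<lambda>\<xi>. fox_kernel m n ups lows \<xi> * (w * of_real ((x - t) powr \<alpha>)) powr \<xi>)"
      have "F t u s = A * (indicator {a<..<t} u *\<^sub>R q u) * l s" for u s
        using True by (simp add: F_def A_def q_def l_def indicator_def)
      then have "(LINT u|lborel. LINT s|lborel. F t u s) =
          A * (LINT u:{a<..<t}|lborel. q u) * integral\<^sup>L lborel l"
        by (simp only: integral_mult_right_zero integral_mult_left_zero set_lebesgue_integral_def)
      then show ?thesis
        using True by (simp add: fox_H_def I_op_def line_integral_def A_def q_def l_def \<kappa>_def)
    next
      case False
      then have "F t u s = 0" for u s by (auto simp: F_def)
      then show ?thesis using False by simp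
    qed
    then show ?thesis
      unfolding H_op_def set_lebesgue_integral_def by (simp only: integral_mult_right_zero)
  qed

  have rhs: "(LINT u:{a<..<x}|lborel. of_real u powr \<gamma> * of_real (x - u) powr (\<mu> + \<beta> - 1) *
       (of_real (x - a) powr (- \<mu> - \<gamma>) / Gamma (\<mu> + \<gamma>)) *
       fox_H2 L L\<^sub>2 1 [(1 - \<beta>, \<alpha>, 1)] [(1 - \<mu> - \<beta>, \<alpha>, 1)] m n ups lows
         1 1 [(1 - \<mu> - \<gamma>, 1)] [(0, 1)]
         (w * of_real ((x - u) powr \<alpha>)) (of_real (- ((x - u) / (x - a)))) * \<phi> u) =
      \<kappa>\<^sup>2 * (LINT u|lborel. LINT s|lborel. LINT r|lborel. G u s r)"
  proof -
    have "indicator {a<..<x} u *\<^sub>R (of_real u powr \<gamma> * of_real (x - u) powr (\<mu> + \<beta> - 1) *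
       (of_real (x - a) powr (- \<mu> - \<gamma>) / Gamma (\<mu> + \<gamma>)) *
       fox_H2 L L\<^sub>2 1 [(1 - \<beta>, \<alpha>, 1)] [(1 - \<mu> - \<beta>, \<alpha>, 1)] m n ups lows
         1 1 [(1 - \<mu> - \<gamma>, 1)] [(0, 1)]
         (w * of_real ((x - u) powr \<alpha>)) (of_real (- ((x - u) / (x - a)))) * \<phi> u) =
        \<kappa>\<^sup>2 * (LINT s|lborel. LINT r|lborel. G u s r)" for u
    proof (cases "u \<in> {a<..<x}")
      case True
      define D where "D = complex_of_real u powr \<gamma> * of_real (x - u) powr (\<mu> + \<beta> - 1) *
        (of_real (x - a) powr (- \<mu> - \<gamma>) / Gamma (\<mu> + \<gamma>)) * \<phi> u"
      define h where "h = ?fox2 u"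
      have "G u s r = D * (line_integrand L\<^sub>2 (h (L s)) r * vector_derivative L (at s))" for s r
        using True by (simp add: G_def D_def h_def line_integrand_def)
      then have "(LINT s|lborel. LINT r|lborel. G u s r) =
          D * line_integral L (\<lambda>\<xi>. line_integral L\<^sub>2 (h \<xi>))"
        by (simp only: integral_mult_right_zero integral_mult_left_zero line_integral_def line_integrand_def[of L])
      then show ?thesis
        using True unfolding fox_H2_def D_def h_def \<kappa>_def power_divide power_one indicator_def
        by (simp only: of_bool_eq if_True scaleR_one mult_ac)
    next
      case False
      then show ?thesis by (simp add: G_0)
    qed
    then show ?thesis
      unfolding set_lebesgue_integral_def by (simp only: integral_mult_right_zero)
  qed

  \<comment> \<open>One contour integral on the left against two on the right leaves a single factor
    \<kappa> in the comparison.\<close>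
  have inner: "AE u in lborel. AE s in lborel. (LINT t|lborel. F t u s) = \<kappa> * (LINT r|lborel. G u s r)"
    using LINT_LINT_LINT_rotate(2)[OF intF]
  proof eventually_elim
    case (elim u)
    show ?case
    proof (cases "u \<in> {a<..<x}")
      case False
      then show ?thesis by (simp add: F_0 G_0)
    next
      case True
      then have u: "a < u" "u < x" by auto
      note contours = H2_contours[rule_format, OF True, unfolded fox_H2_contours_def Let_def]
      have P: "decreasing_poles 1 [(0, 1)] = range of_nat"
        by (auto simp: decreasing_poles_def elim!: nonpos_Ints_cases')
      \<comment> \<open>For every \<xi> on \<open>L\<close>, the poles in \<eta> of the mixed factor
        \<Gamma>(\<beta> + \<alpha> \<xi> + \<eta>) belong to the set on the left of
        \<open>L\<^sub>2\<close>.\<close>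
      have sep: "separates L\<^sub>2 (range of_nat) (increasing_poles 1 [(1 - \<mu> - \<gamma>, 1)] \<union>
          {\<eta>. \<exists>\<xi>\<in>range L. (\<xi>, \<eta>) \<in> mixed_poles 1 [(1 - \<beta>, \<alpha>, 1)]})"
        and disj: "range of_nat \<inter> (increasing_poles 1 [(1 - \<mu> - \<gamma>, 1)] \<union>
          {\<eta>. \<exists>\<xi>\<in>range L. (\<xi>, \<eta>) \<in> mixed_poles 1 [(1 - \<beta>, \<alpha>, 1)]}) = {}"
        using contours unfolding P by auto
      have nats: "range of_nat \<subseteq> side_of L\<^sub>2 (\<lambda>r. Complex r ((c + d) / 2))"
        using separates_right_loop(1)[OF L2_loop(1) sep] .
      have left: "{\<eta>. \<mu> + \<gamma> + \<eta> \<in> \<int>\<^sub>\<le>\<^sub>0 \<or> \<beta> + of_real \<alpha> * L s + \<eta> \<in> \<int>\<^sub>\<le>\<^sub>0} \<subseteq>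
          side_of L\<^sub>2 (\<lambda>r. Complex (- r) 0)" for s
        using separates_right_loop(2)[OF L2_loop(1) sep]
        by (auto simp: increasing_poles_def mixed_poles_def)
      have poles: "\<mu> + \<gamma> + of_nat k \<notin> \<int>\<^sub>\<le>\<^sub>0" for k
        using disj by (auto simp: increasing_poles_def)
      have "integrable (lborel \<Otimes>\<^sub>M lborel) (\<lambda>(s, r). line_integrand L (\<lambda>\<xi>. line_integrand L\<^sub>2 (?fox2 u \<xi>) r) s)"
        using contours by (simp only: lborel_prod)
      \<comment> \<open>Joint integrability along both contours, at this fixed \<open>u\<close>,
        makes the integral along \<open>L\<^sub>2\<close> converge for almost every
        \<open>s\<close>.\<close>
      from lborel_pair.AE_integrable_fst[OF this]
      show ?thesis
        using elim
      proof eventually_elim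
        case (elim s)
        \<comment> \<open>Collects factors common to both sides that depend on neither
          \<open>t\<close> nor \<open>r\<close>; where it vanishes, for instance with \<phi>, both
          inner integrals are 0.\<close>
        define C where "C = fox_kernel m n ups lows (L s) * vector_derivative L (at s) * (of_real u powr \<gamma> * \<phi> u)"
        define f where "f t = of_real (x - t) powr (\<beta> - 1) * (w * of_real ((x - t) powr \<alpha>)) powr L s *
          of_real (t - a) powr (- (\<mu> + \<gamma>)) / of_real (t - u) powr (1 - \<mu>)" for t
        define W where "W = (w * of_real ((x - u) powr \<alpha>)) powr L s"
        have W: "W \<noteq> 0" using \<open>w \<noteq> 0\<close> u by (simp add: W_def)
        have \<Gamma>: "Gamma \<mu> \<noteq> 0"
          using \<open>Re \<mu> > 0\<close> by (auto simp: Gamma_eq_zero_iff elim!: nonpos_Ints_cases')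
        have e: "- \<mu> - \<gamma> = - (\<mu> + \<gamma>)" by simp
        have F: "F t u s = C / Gamma \<mu> * (indicator {u<..<x} t *\<^sub>R f t)" for t
          using u unfolding F_def C_def f_def line_integrand_def e
          by (simp add: indicator_def divide_inverse mult_ac)
        have fox2: "line_integrand L (\<lambda>\<xi>. line_integrand L\<^sub>2 (?fox2 u \<xi>) r) s =
            fox_kernel m n ups lows (L s) * vector_derivative L (at s) * W * line_integrand L\<^sub>2 (?B u s) r" for r
          unfolding line_integrand_def fox2_integrand_eq_barnes W_def by (simp only: mult_ac)
        have G: "G u s r = of_real (x - u) powr (\<mu> + \<beta> - 1) *
            (of_real (x - a) powr (- (\<mu> + \<gamma>)) / Gamma (\<mu> + \<gamma>)) * C * W * line_integrand L\<^sub>2 (?B u s) r" for r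
          using u unfolding G_def fox2 C_def e by (simp add: mult_ac)
        have "C * (LINT t:{u<..<x}|lborel. f t) / Gamma \<mu> =
            of_real (x - u) powr (\<mu> + \<beta> - 1) * (of_real (x - a) powr (- (\<mu> + \<gamma>)) / Gamma (\<mu> + \<gamma>)) * C *
            W * line_integral L\<^sub>2 (?B u s) / (2 * pi * \<i>)"
          unfolding f_def W_def
        proof (rule inner_integrals_eq[OF u \<open>Re \<mu> > 0\<close> \<open>w \<noteq> 0\<close> L2_loop nats left poles])
          assume C: "C \<noteq> 0"
          have "integrable lborel (\<lambda>t. Gamma \<mu> / C * F t u s)"
            by (rule integrable_mult_right) (rule elim)
          also have "(\<lambda>t. Gamma \<mu> / C * F t u s) = (\<lambda>t. indicator {u<..<x} t *\<^sub>R f t)"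
            using C \<Gamma> by (simp add: F)
          finally show "set_integrable lborel {u<..<x} (\<lambda>t. of_real (x - t) powr (\<beta> - 1) *
              (w * of_real ((x - t) powr \<alpha>)) powr L s *
              of_real (t - a) powr (- (\<mu> + \<gamma>)) / of_real (t - u) powr (1 - \<mu>))"
            unfolding set_integrable_def f_def .
          define k where "k = fox_kernel m n ups lows (L s) * vector_derivative L (at s) * W"
          have "k \<noteq> 0" using C W by (auto simp: C_def k_def)
          moreover have "integrable lborel (\<lambda>r. inverse k * (k * line_integrand L\<^sub>2 (?B u s) r))"
            by (rule integrable_mult_right) (use elim in \<open>simp only: fox2 k_def\<close>)
          ultimately show "integrable lborel (line_integrand L\<^sub>2 (?B u s))"
            by (simp add: mult.assoc[symmetric])
        qed
        moreover have "(LINT t|lborel. F t u s) = C / Gamma \<mu> * (LINT t:{u<..<x}|lborel. f t)"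
          by (simp only: F set_lebesgue_integral_def integral_mult_right_zero)
        moreover have "(LINT r|lborel. G u s r) = of_real (x - u) powr (\<mu> + \<beta> - 1) *
            (of_real (x - a) powr (- (\<mu> + \<gamma>)) / Gamma (\<mu> + \<gamma>)) * C * W * line_integral L\<^sub>2 (?B u s)"
          by (simp only: G line_integral_def integral_mult_right_zero)
        moreover have "y / (2 * pi * \<i>) = \<kappa> * y" for y by (simp add: \<kappa>_def)
        ultimately show ?case by (simp only: times_divide_eq_left)
      qed
    qed
  qed

  \<comment> \<open>The almost-everywhere comparison of iterated integrals requires measurability,
    which is available for the uncurried functions on the product space.\<close>
  define F' where "F' = (\<lambda>(t, u, s). F t u s)"
  define G' where "G' = (\<lambda>(u, s, r). G u s r)"
  have [measurable]: "F' \<in> borel_measurable (lborel \<Otimes>\<^sub>M (lborel \<Otimes>\<^sub>M lborel))"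
    "G' \<in> borel_measurable (lborel \<Otimes>\<^sub>M (lborel \<Otimes>\<^sub>M lborel))"
    using intF intG by (auto simp: F'_def G'_def lborel_prod)
  have "(LINT u|lborel. LINT s|lborel. LINT t|lborel. F' (t, u, s)) =
      (LINT u|lborel. LINT s|lborel. \<kappa> * (LINT r|lborel. G' (u, s, r)))"
  proof (rule integral_cong_AE)
    show "AE u in lborel. (LINT s|lborel. LINT t|lborel. F' (t, u, s)) =
        (LINT s|lborel. \<kappa> * (LINT r|lborel. G' (u, s, r)))"
      using inner
    proof eventually_elim
      case (elim u)
      show ?case
        by (rule integral_cong_AE) (use elim in \<open>measurable, simp add: F'_def G'_def\<close>)
    qed
  qed measurable
  then have "(LINT u|lborel. LINT s|lborel. LINT t|lborel. F t u s) =
      \<kappa> * (LINT u|lborel. LINT s|lborel. LINT r|lborel. G u s r)"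
    by (simp add: F'_def G'_def)
  then show ?thesis
    unfolding lhs rhs LINT_LINT_LINT_rotate(1)[OF intF] by (simp add: power2_eq_square)
qed

end
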